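(* Let $G$ be a finite abelian group, $\mathbb{k}$ a field, $g, g_0 \in G$, and let $V, W$ be finite-dimensional $G$-graded $\mathbb{k}$-vector spaces. Then $$(V \otimes_{g_0} W)_g \cong (V \otimes W)_{g g_0}.$$
   Context: A $G$-graded vector space is a direct sum $V = \bigoplus_{g \in G} V_g$; it is finite-dimensional if every $V_g$ is. The tensor product is $(V \otimes W)_g = \bigoplus_{hk=g} V_h \otimes W_k$. $\mathbb{k}_{g_0}$ is the graded vector space with $(\mathbb{k}_{g_0})_h = \delta_{g_0,h}\mathbb{k}$. The graded space $\underline{\mathrm{Hom}}(V,W)$ has as degree-$g$ component the space of linear maps $f: V \to W$ with $f(V_h) \subseteq W_{gh}$ for all $h \in G$. Set $V^{g_0} := \underline{\mathrm{Hom}}(V, \mathbb{k}_{g_0})$ and $V \otimes_{g_0} W := (V^{g_0} \otimes W^{g_0})^{g_0}$. *)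

theory Defs
  imports "Jordan_Normal_Form.Missing_VectorSpace" "HOL-Algebra.AbelCoset"
begin

text \<open>
  Vector spaces over \<open>K\<close> are carrier-based, as in the locale \<^locale>\<open>vectorspace\<close>. The ring
  multiplication and unit of a \<^type>\<open>module_ext\<close> record play no role for modules, so the
  constructions below leave them unspecified.
\<close>

section \<open>Linear algebra\<close>

definition isomorphic_modules ::
  "('k, 'r) ring_scheme \<Rightarrow> ('k, 'v, 'm) module_scheme \<Rightarrow> ('k, 'w, 'n) module_scheme \<Rightarrow> bool"
  where "isomorphic_modules K V W \<longleftrightarrow>
    (\<exists>f \<in> module_hom K V W. bij_betw f (carrier V) (carrier W))"

definition self_module :: "('k, 'r) ring_scheme \<Rightarrow> ('k, 'k) module"
  where "self_module K =
    \<lparr>carrier = carrier K, mult = undefined, one = undefined,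
     zero = \<zero>\<^bsub>K\<^esub>, add = add K, smult = mult K\<rparr>"

text \<open>The external direct sum of a family of modules: finitely supported families, which are
  \<^const>\<open>undefined\<close> outside the index set.\<close>

definition ext_direct_sum ::
  "'i set \<Rightarrow> ('i \<Rightarrow> ('k, 'v, 'm) module_scheme) \<Rightarrow> ('k, 'i \<Rightarrow> 'v) module"
  where "ext_direct_sum I M =
    \<lparr>carrier = {x \<in> (\<Pi>\<^sub>E i\<in>I. carrier (M i)). finite {i \<in> I. x i \<noteq> \<zero>\<^bsub>M i\<^esub>}},
     mult = undefined, one = undefined,
     zero = (\<lambda>i\<in>I. \<zero>\<^bsub>M i\<^esub>),
     add = (\<lambda>x y. \<lambda>i\<in>I. x i \<oplus>\<^bsub>M i\<^esub> y i),
     smult = (\<lambda>c x. \<lambda>i\<in>I. c \<odot>\<^bsub>M i\<^esub> x i)\<rparr>"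

definition ext_direct_sum_inj ::
  "'i set \<Rightarrow> ('i \<Rightarrow> ('k, 'v, 'm) module_scheme) \<Rightarrow> 'i \<Rightarrow> 'v \<Rightarrow> 'i \<Rightarrow> 'v"
  where "ext_direct_sum_inj I M i v = (\<lambda>j\<in>I. if j = i then v else \<zero>\<^bsub>M j\<^esub>)"

definition quotient_module ::
  "('k, 'v, 'm) module_scheme \<Rightarrow> 'v set \<Rightarrow> ('k, 'v set) module"
  where "quotient_module M N =
    \<lparr>carrier = a_rcosets\<^bsub>M\<^esub> N, mult = undefined, one = undefined,
     zero = N, add = set_add M,
     smult = (\<lambda>c X. \<Union>x\<in>X. N +>\<^bsub>M\<^esub> (c \<odot>\<^bsub>M\<^esub> x))\<rparr>"

definition free_module :: "('k, 'r) ring_scheme \<Rightarrow> 's set \<Rightarrow> ('k, 's \<Rightarrow> 'k) module"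
  where "free_module K S = ext_direct_sum S (\<lambda>_. self_module K)"

definition free_gen :: "('k, 'r) ring_scheme \<Rightarrow> 's set \<Rightarrow> 's \<Rightarrow> 's \<Rightarrow> 'k"
  where "free_gen K S s = ext_direct_sum_inj S (\<lambda>_. self_module K) s \<one>\<^bsub>K\<^esub>"

text \<open>The tensor product is the free module on pairs of vectors modulo the bilinearity relations.\<close>

definition bilinearity_relations ::
  "('k, 'r) ring_scheme \<Rightarrow> ('k, 'v, 'm) module_scheme \<Rightarrow> ('k, 'w, 'n) module_scheme \<Rightarrow>
   ('v \<times> 'w \<Rightarrow> 'k) set"
  where "bilinearity_relations K V W =
    (let F = free_module K (carrier V \<times> carrier W);
         \<delta> = (\<lambda>v w. free_gen K (carrier V \<times> carrier W) (v, w))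
     in {\<delta> (v \<oplus>\<^bsub>V\<^esub> v') w \<ominus>\<^bsub>F\<^esub> (\<delta> v w \<oplus>\<^bsub>F\<^esub> \<delta> v' w) | v v' w.
            v \<in> carrier V \<and> v' \<in> carrier V \<and> w \<in> carrier W}
      \<union> {\<delta> v (w \<oplus>\<^bsub>W\<^esub> w') \<ominus>\<^bsub>F\<^esub> (\<delta> v w \<oplus>\<^bsub>F\<^esub> \<delta> v w') | v w w'.
            v \<in> carrier V \<and> w \<in> carrier W \<and> w' \<in> carrier W}
      \<union> {\<delta> (c \<odot>\<^bsub>V\<^esub> v) w \<ominus>\<^bsub>F\<^esub> c \<odot>\<^bsub>F\<^esub> \<delta> v w | c v w.
            c \<in> carrier K \<and> v \<in> carrier V \<and> w \<in> carrier W}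
      \<union> {\<delta> v (c \<odot>\<^bsub>W\<^esub> w) \<ominus>\<^bsub>F\<^esub> c \<odot>\<^bsub>F\<^esub> \<delta> v w | c v w.
            c \<in> carrier K \<and> v \<in> carrier V \<and> w \<in> carrier W})"

definition tensor_product ::
  "('k, 'r) ring_scheme \<Rightarrow> ('k, 'v, 'm) module_scheme \<Rightarrow> ('k, 'w, 'n) module_scheme \<Rightarrow>
   ('k, ('v \<times> 'w \<Rightarrow> 'k) set) module"
  where "tensor_product K V W =
    (let F = free_module K (carrier V \<times> carrier W)
     in quotient_module F (LinearCombinations.module.span K F (bilinearity_relations K V W)))"


section \<open>Graded vector spaces\<close>

text \<open>
  A graded vector space is given by the family of its homogeneous components; only the components
  at \<open>g \<in> carrier G\<close> matter. That all components of one space share an element type is no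
  restriction, as they can be embedded into the total space. The underlying vector space is their external direct sum, in which
  the component of degree \<open>g\<close> sits as the subset \<open>homogeneous_part G V g\<close>.
\<close>

type_synonym ('g, 'k, 'v) graded = "'g \<Rightarrow> ('k, 'v) module"

definition graded_vectorspace ::
  "('g, 'a) monoid_scheme \<Rightarrow> ('k, 'r) ring_scheme \<Rightarrow> ('g, 'k, 'v) graded \<Rightarrow> bool"
  where "graded_vectorspace G K V \<longleftrightarrow> (\<forall>g\<in>carrier G. vectorspace K (V g))"

definition graded_fin_dim ::
  "('g, 'a) monoid_scheme \<Rightarrow> ('k, 'r) ring_scheme \<Rightarrow> ('g, 'k, 'v) graded \<Rightarrow> bool"
  where "graded_fin_dim G K V \<longleftrightarrow> (\<forall>g\<in>carrier G. vectorspace.fin_dim K (V g))"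

definition total_space ::
  "('g, 'a) monoid_scheme \<Rightarrow> ('g, 'k, 'v) graded \<Rightarrow> ('k, 'g \<Rightarrow> 'v) module"
  where "total_space G V = ext_direct_sum (carrier G) V"

definition homogeneous_part ::
  "('g, 'a) monoid_scheme \<Rightarrow> ('g, 'k, 'v) graded \<Rightarrow> 'g \<Rightarrow> ('g \<Rightarrow> 'v) set"
  where "homogeneous_part G V g = ext_direct_sum_inj (carrier G) V g ` carrier (V g)"

definition graded_tensor ::
  "('g, 'a) monoid_scheme \<Rightarrow> ('k, 'r) ring_scheme \<Rightarrow> ('g, 'k, 'v) graded \<Rightarrow> ('g, 'k, 'w) graded \<Rightarrow>
   ('g, 'k, 'g \<times> 'g \<Rightarrow> ('v \<times> 'w \<Rightarrow> 'k) set) graded"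
  where "graded_tensor G K V W = (\<lambda>g.
    ext_direct_sum {(h, k). h \<in> carrier G \<and> k \<in> carrier G \<and> h \<otimes>\<^bsub>G\<^esub> k = g}
      (\<lambda>(h, k). tensor_product K (V h) (W k)))"

definition graded_line :: "('k, 'r) ring_scheme \<Rightarrow> 'g \<Rightarrow> ('g, 'k, 'k) graded"
  where "graded_line K g\<^sub>0 = (\<lambda>h.
    if h = g\<^sub>0 then self_module K else self_module K \<lparr>carrier := {\<zero>\<^bsub>K\<^esub>}\<rparr>)"

text \<open>Linear maps are taken \<^const>\<open>extensional\<close>, so that equality of elements of the Hom space
  is equality of maps on the total space.\<close>

definition graded_Hom ::
  "('g, 'a) monoid_scheme \<Rightarrow> ('k, 'r) ring_scheme \<Rightarrow> ('g, 'k, 'v) graded \<Rightarrow> ('g, 'k, 'w) graded \<Rightarrow>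
   ('g, 'k, ('g \<Rightarrow> 'v) \<Rightarrow> ('g \<Rightarrow> 'w)) graded"
  where "graded_Hom G K V W = (\<lambda>g.
    \<lparr>carrier = {f \<in> module_hom K (total_space G V) (total_space G W)
                  \<inter> extensional (carrier (total_space G V)).
                \<forall>h\<in>carrier G. f ` homogeneous_part G V h \<subseteq> homogeneous_part G W (g \<otimes>\<^bsub>G\<^esub> h)},
     mult = undefined, one = undefined,
     zero = (\<lambda>x\<in>carrier (total_space G V). \<zero>\<^bsub>total_space G W\<^esub>),
     add = (\<lambda>f f'. \<lambda>x\<in>carrier (total_space G V). f x \<oplus>\<^bsub>total_space G W\<^esub> f' x),
     smult = (\<lambda>c f. \<lambda>x\<in>carrier (total_space G V). c \<odot>\<^bsub>total_space G W\<^esub> f x)\<rparr>)"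

text \<open>\<open>V\<^sup>g\<^sup>0\<close>, the dual of \<open>V\<close> shifted by \<open>g\<^sub>0\<close>, and the associated product
  \<open>V \<otimes>\<^sub>g\<^sub>0 W = (V\<^sup>g\<^sup>0 \<otimes> W\<^sup>g\<^sup>0)\<^sup>g\<^sup>0\<close>.\<close>

definition graded_dual ::
  "('g, 'a) monoid_scheme \<Rightarrow> ('k, 'r) ring_scheme \<Rightarrow> 'g \<Rightarrow> ('g, 'k, 'v) graded \<Rightarrow>
   ('g, 'k, ('g \<Rightarrow> 'v) \<Rightarrow> ('g \<Rightarrow> 'k)) graded"
  where "graded_dual G K g\<^sub>0 V = graded_Hom G K V (graded_line K g\<^sub>0)"

definition dual_graded_tensor
  where "dual_graded_tensor G K g\<^sub>0 V W =
    graded_dual G K g\<^sub>0 (graded_tensor G K (graded_dual G K g\<^sub>0 V) (graded_dual G K g\<^sub>0 W))"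

end

theory Submission
  imports Defs
begin

text \<open>
  Choose finite bases \<open>B\<^sub>h\<close> of \<open>V\<^sub>h\<close> and \<open>C\<^sub>k\<close> of \<open>W\<^sub>k\<close>. A degree-\<open>g\<close> map into the line in degree \<open>g\<^sub>0\<close>
  is a functional on the component of degree \<open>t g = g\<inverse> g\<^sub>0\<close>, so the shifted dual has a basis indexed
  by \<open>B\<^bsub>t g\<^esub>\<close> in degree \<open>g\<close>. Hence \<open>(V \<otimes>\<^sub>g\<^sub>0 W)\<^sub>g\<close> has a basis indexed by
  the triples consisting of \<open>(h, k)\<close> with \<open>h k = t g\<close> and an element of \<open>B\<^bsub>t h\<^esub> \<times> C\<^bsub>t k\<^esub>\<close>.
  The involution \<open>t\<close> turns the condition into \<open>(t h) (t k) = g g\<^sub>0\<close>, so this index set is in bijection with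
  that of the basis of \<open>(V \<otimes> W)\<^bsub>g g\<^sub>0\<^esub>\<close>.
\<close>

section \<open>Direct sums\<close>

text \<open>The canonical route passes through double duals and the map from a tensor product of
  duals to the dual of a tensor product, which is awkward when tensor products are quotients of huge
  free modules. Instead each construction is shown to turn modules with a basis into modules with a
  basis and an explicit index set; the final isomorphism comes from a bijection of index sets and
  depends on the chosen bases. Records made of cosets or of restricted maps come without module
  axioms, so \<open>free_over\<close> carries these along; they are obtained by transport along a
  bijection. A dual has such a basis only over a finite index set. For the outer dual this set is
  finite because \<open>G\<close> and all chosen bases are. Commutativity enters through
  \<open>t\<close>: in a general group \<open>t (t g)\<close> is the conjugate of \<open>g\<close>
  by \<open>g\<^sub>0\<close>.\<close>

lemma ext_direct_sum_simps [simp]: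
  "x \<in> carrier (ext_direct_sum I M) \<longleftrightarrow>
    x \<in> (\<Pi>\<^sub>E i\<in>I. carrier (M i)) \<and> finite {i \<in> I. x i \<noteq> \<zero>\<^bsub>M i\<^esub>}"
  "\<zero>\<^bsub>ext_direct_sum I M\<^esub> = (\<lambda>i\<in>I. \<zero>\<^bsub>M i\<^esub>)"
  "x \<oplus>\<^bsub>ext_direct_sum I M\<^esub> y = (\<lambda>i\<in>I. x i \<oplus>\<^bsub>M i\<^esub> y i)"
  "c \<odot>\<^bsub>ext_direct_sum I M\<^esub> x = (\<lambda>i\<in>I. c \<odot>\<^bsub>M i\<^esub> x i)"
  by (simp_all add: ext_direct_sum_def)

lemma self_module_simps [simp]:
  "carrier (self_module K) = carrier K" "\<zero>\<^bsub>self_module K\<^esub> = \<zero>\<^bsub>K\<^esub>"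
  "x \<oplus>\<^bsub>self_module K\<^esub> y = x \<oplus>\<^bsub>K\<^esub> y" "c \<odot>\<^bsub>self_module K\<^esub> x = c \<otimes>\<^bsub>K\<^esub> x"
  by (simp_all add: self_module_def)

lemma (in cring) module_self_module: "module R (self_module R)"
  by (rule moduleI, rule is_cring, rule abelian_groupI)
    (auto simp: l_distr r_distr m_assoc a_assoc intro: a_comm bexI[of _ "\<ominus> _"] l_neg)

lemma module_ext_direct_sum:
  assumes K: "cring K" and M: "\<And>i. i \<in> I \<Longrightarrow> module K (M i)"
  shows "module K (ext_direct_sum I M)"
proof -
  note ag = module.axioms(2)[OF M]
  note am = abelian_group.axioms(1)[OF ag]
  note closed = abelian_monoid.a_closed[OF am] abelian_monoid.zero_closed[OF am] 
    module.smult_closed[OF M] abelian_group.a_inv_closed[OF ag]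
  have neg0: "\<ominus>\<^bsub>M i\<^esub> \<zero>\<^bsub>M i\<^esub> = \<zero>\<^bsub>M i\<^esub>" if "i \<in> I" for i
    by (metis that closed(2,4) abelian_group.l_neg[OF ag] abelian_monoid.r_zero[OF am])
  have add: "x \<oplus>\<^bsub>ext_direct_sum I M\<^esub> y \<in> carrier (ext_direct_sum I M)"
    if x: "x \<in> carrier (ext_direct_sum I M)" and y: "y \<in> carrier (ext_direct_sum I M)" for x y
  proof -
    have "{i \<in> I. x i \<oplus>\<^bsub>M i\<^esub> y i \<noteq> \<zero>\<^bsub>M i\<^esub>} \<subseteq> {i \<in> I. x i \<noteq> \<zero>\<^bsub>M i\<^esub>} \<union> {i \<in> I. y i \<noteq> \<zero>\<^bsub>M i\<^esub>}"
      using abelian_monoid.l_zero[OF am] closed by auto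
    from finite_subset[OF this] show ?thesis
      using x y by (auto simp: PiE_iff closed cong: conj_cong)
  qed
  have smult: "c \<odot>\<^bsub>ext_direct_sum I M\<^esub> x \<in> carrier (ext_direct_sum I M)"
    if c: "c \<in> carrier K" and x: "x \<in> carrier (ext_direct_sum I M)" for c x
  proof -
    have "{i \<in> I. c \<odot>\<^bsub>M i\<^esub> x i \<noteq> \<zero>\<^bsub>M i\<^esub>} \<subseteq> {i \<in> I. x i \<noteq> \<zero>\<^bsub>M i\<^esub>}"
      using module.smult_r_null[OF M c] by auto
    from finite_subset[OF this] show ?thesis
      using c x by (auto simp: PiE_iff closed cong: conj_cong)
  qed
  have neg: "(\<lambda>i\<in>I. \<ominus>\<^bsub>M i\<^esub> x i) \<in> carrier (ext_direct_sum I M)"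
    if x: "x \<in> carrier (ext_direct_sum I M)" for x
  proof -
    have "{i \<in> I. \<ominus>\<^bsub>M i\<^esub> x i \<noteq> \<zero>\<^bsub>M i\<^esub>} \<subseteq> {i \<in> I. x i \<noteq> \<zero>\<^bsub>M i\<^esub>}"
      using neg0 by auto
    from finite_subset[OF this] show ?thesis
      using x by (auto simp: PiE_iff closed cong: conj_cong)
  qed
  have "abelian_group (ext_direct_sum I M)"
  proof (rule abelian_groupI)
    fix x assume x: "x \<in> carrier (ext_direct_sum I M)"
    then show "\<exists>y\<in>carrier (ext_direct_sum I M).
        y \<oplus>\<^bsub>ext_direct_sum I M\<^esub> x = \<zero>\<^bsub>ext_direct_sum I M\<^esub>"
      by (intro bexI[OF _ neg]) (auto intro!: restrict_ext abelian_group.l_neg[OF ag])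
    show "\<zero>\<^bsub>ext_direct_sum I M\<^esub> \<oplus>\<^bsub>ext_direct_sum I M\<^esub> x = x"
      using x by (auto simp: fun_eq_iff PiE_iff extensional_def abelian_monoid.l_zero[OF am])
  qed (use add in \<open>auto simp: closed PiE_iff abelian_monoid.a_assoc[OF am] 
         intro!: restrict_ext intro: abelian_monoid.a_comm[OF am] cong: conj_cong\<close>)
  then show ?thesis
  proof (rule moduleI[OF K])
    fix x assume "x \<in> carrier (ext_direct_sum I M)"
    then show "\<one>\<^bsub>K\<^esub> \<odot>\<^bsub>ext_direct_sum I M\<^esub> x = x"
      by (auto simp: fun_eq_iff PiE_iff extensional_def module.smult_one[OF M])
  qed (use smult in \<open>auto simp: PiE_iff closed module.smult_l_distr[OF M] module.smult_r_distr[OF M]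
         module.smult_assoc1[OF M] intro!: restrict_ext\<close>)
qed

lemma ext_direct_sum_inj_closed:
  assumes "\<And>i. i \<in> I \<Longrightarrow> module K (M i)" "i \<in> I" "v \<in> carrier (M i)"
  shows "ext_direct_sum_inj I M i v \<in> carrier (ext_direct_sum I M)"
proof -
  have "\<zero>\<^bsub>M j\<^esub> \<in> carrier (M j)" if "j \<in> I" for j
    using assms(1)[OF that] by (simp add: module_def abelian_group_def abelian_monoid.zero_closed)
  moreover have "{j \<in> I. (if j = i then v else \<zero>\<^bsub>M j\<^esub>) \<noteq> \<zero>\<^bsub>M j\<^esub>} \<subseteq> {i}" by auto
  from finite_subset[OF this] have "finite {j \<in> I. (if j = i then v else \<zero>\<^bsub>M j\<^esub>) \<noteq> \<zero>\<^bsub>M j\<^esub>}" by simp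
  ultimately show ?thesis
    using assms(2,3) by (auto simp: ext_direct_sum_inj_def cong: conj_cong)
qed

text \<open>Finite support makes every element a finite sum of injected vectors. The induction runs
  over an arbitrary finite superset \<open>A\<close> of the support: a removed index
  \<open>j\<close> may then lie outside \<open>I\<close> or carry a zero coordinate, and erasing
  coordinate \<open>j\<close> always leaves a support inside the smaller set.\<close>

lemma ext_direct_sum_induct [consumes 1, case_names module zero inj add]:
  assumes x: "x \<in> carrier (ext_direct_sum I M)"
    and M: "\<And>i. i \<in> I \<Longrightarrow> module K (M i)"
    and zero: "P \<zero>\<^bsub>ext_direct_sum I M\<^esub>"
    and inj: "\<And>i v. i \<in> I \<Longrightarrow> v \<in> carrier (M i) \<Longrightarrow> P (ext_direct_sum_inj I M i v)"
    and add: "\<And>x y. x \<in> carrier (ext_direct_sum I M) \<Longrightarrow> y \<in> carrier (ext_direct_sum I M) \<Longrightarrow>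
      P x \<Longrightarrow> P y \<Longrightarrow> P (x \<oplus>\<^bsub>ext_direct_sum I M\<^esub> y)"
  shows "P x"
proof -
  note am = abelian_group.axioms(1)[OF module.axioms(2)[OF M]]
  have "P x" if "finite A" "{i \<in> I. x i \<noteq> \<zero>\<^bsub>M i\<^esub>} \<subseteq> A" "x \<in> carrier (ext_direct_sum I M)" for A x
    using that
  proof (induction A arbitrary: x rule: finite_induct)
    case empty
    then have "x = \<zero>\<^bsub>ext_direct_sum I M\<^esub>"
      by (auto simp: fun_eq_iff PiE_iff extensional_def)
    then show ?case using zero by (simp del: ext_direct_sum_simps)
  next
    case (insert j A)
    show ?case
    proof (cases "j \<in> I")
      case False
      then show ?thesis using insert by auto
    next
      case True
      define y where "y = (\<lambda>i\<in>I. if i = j then \<zero>\<^bsub>M i\<^esub> else x i)"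
      have xj: "x j \<in> carrier (M j)" using insert.prems True by auto
      have sub: "{i \<in> I. y i \<noteq> \<zero>\<^bsub>M i\<^esub>} \<subseteq> A" using insert.prems by (auto simp: y_def)
      have y: "y \<in> carrier (ext_direct_sum I M)"
        using insert.prems finite_subset[OF sub insert.hyps(1)] abelian_monoid.zero_closed[OF am]
        by (auto simp: y_def PiE_iff cong: conj_cong)
      have "x = ext_direct_sum_inj I M j (x j) \<oplus>\<^bsub>ext_direct_sum I M\<^esub> y"
        using insert.prems
        by (auto simp: fun_eq_iff PiE_iff extensional_def y_def ext_direct_sum_inj_def
            abelian_monoid.l_zero[OF am] abelian_monoid.r_zero[OF am])
      then show ?thesis
        using add[OF ext_direct_sum_inj_closed[of I K M, OF M True xj] y inj[OF True xj]
            insert.IH[OF sub y]] by simp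
    qed
  qed
  then show ?thesis using x by auto
qed

section \<open>Free modules\<close>

lemma module_homI:
  assumes "\<And>x. x \<in> carrier M \<Longrightarrow> f x \<in> carrier N"
    and "\<And>x y. x \<in> carrier M \<Longrightarrow> y \<in> carrier M \<Longrightarrow> f (x \<oplus>\<^bsub>M\<^esub> y) = f x \<oplus>\<^bsub>N\<^esub> f y"
    and "\<And>c x. c \<in> carrier K \<Longrightarrow> x \<in> carrier M \<Longrightarrow> f (c \<odot>\<^bsub>M\<^esub> x) = c \<odot>\<^bsub>N\<^esub> f x"
  shows "f \<in> module_hom K M N"
  using assms by (auto simp: module_hom_def)

lemma module_hom_in_carrier:
  "f \<in> module_hom K M N \<Longrightarrow> x \<in> carrier M \<Longrightarrow> f x \<in> carrier N"
  by (auto simp: module_hom_def)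

lemma module_hom_comp:
  "f \<in> module_hom K M N \<Longrightarrow> g \<in> module_hom K N L \<Longrightarrow> g \<circ> f \<in> module_hom K M L"
  by (auto simp: module_hom_def Pi_iff)

lemma module_hom_zero:
  assumes "module K M" "module K N" "f \<in> module_hom K M N"
  shows "f \<zero>\<^bsub>M\<^esub> = \<zero>\<^bsub>N\<^esub>"
proof -
  interpret mod_hom K M N f
    using assms by (simp add: mod_hom_def mod_hom_axioms_def)
  show ?thesis by simp
qed

lemma module_free_module: "cring K \<Longrightarrow> module K (free_module K S)"
  by (simp add: free_module_def module_ext_direct_sum cring.module_self_module)

lemma free_gen_closed: "cring K \<Longrightarrow> s \<in> S \<Longrightarrow> free_gen K S s \<in> carrier (free_module K S)"
  unfolding free_gen_def free_module_def
  by (rule ext_direct_sum_inj_closed[of _ K]) 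
    (auto simp: cring.module_self_module cring_def ring.ring_simprules)

text \<open>In the summand of index \<open>s\<close> every vector is a scalar multiple of the
  generator, so closure under scalars reduces the case of injected vectors to the generators
  alone.\<close>

lemma free_module_induct [consumes 2, case_names zero gen add smult]:
  assumes K: "cring K" and x: "x \<in> carrier (free_module K S)"
    and zero: "P \<zero>\<^bsub>free_module K S\<^esub>"
    and gen: "\<And>s. s \<in> S \<Longrightarrow> P (free_gen K S s)"
    and add: "\<And>x y. x \<in> carrier (free_module K S) \<Longrightarrow> y \<in> carrier (free_module K S) \<Longrightarrow>
      P x \<Longrightarrow> P y \<Longrightarrow> P (x \<oplus>\<^bsub>free_module K S\<^esub> y)"
    and smult: "\<And>c x. c \<in> carrier K \<Longrightarrow> x \<in> carrier (free_module K S) \<Longrightarrow> P x \<Longrightarrow>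
      P (c \<odot>\<^bsub>free_module K S\<^esub> x)"
  shows "P x"
proof -
  interpret cring K by fact
  show ?thesis
    using x[unfolded free_module_def]
  proof (rule ext_direct_sum_induct)
    show "module K (self_module K)" by (rule module_self_module)
    show "P \<zero>\<^bsub>ext_direct_sum S (\<lambda>_. self_module K)\<^esub>"
      using zero by (simp add: free_module_def)
    fix s c assume s: "s \<in> S" and "c \<in> carrier (self_module K)"
    then have c: "c \<in> carrier K" by simp
    have "ext_direct_sum_inj S (\<lambda>_. self_module K) s c = c \<odot>\<^bsub>free_module K S\<^esub> free_gen K S s"
      using c by (auto simp: free_module_def free_gen_def ext_direct_sum_inj_def fun_eq_iff)
    then show "P (ext_direct_sum_inj S (\<lambda>_. self_module K) s c)"
      using smult[OF c free_gen_closed[OF K s] gen[OF s]] by simp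
  next
    fix x y assume "x \<in> carrier (ext_direct_sum S (\<lambda>_. self_module K))"
      "y \<in> carrier (ext_direct_sum S (\<lambda>_. self_module K))" "P x" "P y"
    then show "P (x \<oplus>\<^bsub>ext_direct_sum S (\<lambda>_. self_module K)\<^esub> y)"
      using add[unfolded free_module_def] by blast
  qed
qed

text \<open>The uniqueness half of the universal property of free modules;
  \<open>free_module_lift\<close> is the existence half.\<close>

lemma free_module_hom_eqI:
  assumes K: "cring K" and M: "module K M"
    and f: "f \<in> module_hom K (free_module K S) M" and g: "g \<in> module_hom K (free_module K S) M"
    and eq: "\<And>s. s \<in> S \<Longrightarrow> f (free_gen K S s) = g (free_gen K S s)"
    and x: "x \<in> carrier (free_module K S)"
  shows "f x = g x"
  using K x
proof (induction rule: free_module_induct)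
  case zero
  then show ?case using module_hom_zero[OF module_free_module[OF K] M f]
      module_hom_zero[OF module_free_module[OF K] M g] by simp
qed (use eq module_hom_add[OF f] module_hom_add[OF g] module_hom_smult[OF f] module_hom_smult[OF g]
      in auto)

lemma ext_direct_sum_hom_eqI:
  assumes M: "\<And>i. i \<in> I \<Longrightarrow> module K (M i)" and K: "cring K" and N: "module K N"
    and f: "f \<in> module_hom K (ext_direct_sum I M) N"
    and g: "g \<in> module_hom K (ext_direct_sum I M) N"
    and eq: "\<And>i v. i \<in> I \<Longrightarrow> v \<in> carrier (M i) \<Longrightarrow>
      f (ext_direct_sum_inj I M i v) = g (ext_direct_sum_inj I M i v)"
    and x: "x \<in> carrier (ext_direct_sum I M)"
  shows "f x = g x"
  using x
proof (induction rule: ext_direct_sum_induct[where K = K])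
  case zero
  have "module K (ext_direct_sum I M)"
    using K M by (rule module_ext_direct_sum)
  then show ?case using module_hom_zero[OF _ N] f g by metis
qed (use M eq module_hom_add[OF f] module_hom_add[OF g] in \<open>auto simp del: ext_direct_sum_simps\<close>)

lemma free_module_lift:
  assumes M: "module K M" and u: "\<And>s. s \<in> S \<Longrightarrow> u s \<in> carrier M"
  obtains f where "f \<in> module_hom K (free_module K S) M"
    "\<And>s. s \<in> S \<Longrightarrow> f (free_gen K S s) = u s"
proof -
  interpret module K M by fact
  let ?F = "free_module K S"
  define supp where "supp x = {s \<in> S. x s \<noteq> \<zero>\<^bsub>K\<^esub>}" for x :: "_ \<Rightarrow> 'a"
  define f where "f x = (\<Oplus>\<^bsub>M\<^esub>s\<in>supp x. x s \<odot>\<^bsub>M\<^esub> u s)" for x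
  have F: "x \<in> carrier ?F \<longleftrightarrow> x \<in> S \<rightarrow>\<^sub>E carrier K \<and> finite (supp x)" for x
    by (simp add: free_module_def supp_def)
  interpret F: module K ?F by (rule module_free_module) (rule R.is_cring)
  \<comment> \<open>The range of summation in \<open>f x\<close> varies with \<open>x\<close>.
    Enlarging it to any finite set containing the support lets \<open>f x\<close>,
    \<open>f y\<close> and \<open>f\<close> of their sum be compared term by term over one
    set.\<close>
  have f_eq: "f x = (\<Oplus>\<^bsub>M\<^esub>s\<in>A. x s \<odot>\<^bsub>M\<^esub> u s)"
    if "x \<in> carrier ?F" "finite A" "supp x \<subseteq> A" "A \<subseteq> S" for x A
    unfolding f_def
    by (rule M.add.finprod_mono_neutral_cong_left)
      (use that u in \<open>auto simp: F supp_def PiE_iff intro!: smult_l_null\<close>)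
  have coeff: "x s \<in> carrier K" if "x \<in> carrier ?F" "s \<in> S" for x s
    using that by (auto simp: F)
  have "f \<in> module_hom K ?F M"
  proof (rule module_homI)
    fix x assume x: "x \<in> carrier ?F"
    then show "f x \<in> carrier M"
      unfolding f_def by (auto intro!: M.finsum_closed simp: supp_def coeff u)
    {
      fix y assume y: "y \<in> carrier ?F"
      let ?A = "supp x \<union> supp y"
      have A: "finite ?A" "?A \<subseteq> S" using x y by (auto simp: F supp_def)
      have sub: "supp (x \<oplus>\<^bsub>?F\<^esub> y) \<subseteq> ?A"
        by (auto simp: supp_def free_module_def)
      have "f (x \<oplus>\<^bsub>?F\<^esub> y) = (\<Oplus>\<^bsub>M\<^esub>s\<in>?A. (x \<oplus>\<^bsub>?F\<^esub> y) s \<odot>\<^bsub>M\<^esub> u s)"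
        using x y A sub by (intro f_eq) auto
      also have "\<dots> = (\<Oplus>\<^bsub>M\<^esub>s\<in>?A. x s \<odot>\<^bsub>M\<^esub> u s \<oplus>\<^bsub>M\<^esub> y s \<odot>\<^bsub>M\<^esub> u s)"
        using A(2) coeff[OF x] coeff[OF y] u
        by (intro M.finsum_cong') (auto simp: free_module_def smult_l_distr subset_iff)
      also have "\<dots> = f x \<oplus>\<^bsub>M\<^esub> f y"
        using A coeff[OF x] coeff[OF y] u x y
        by (subst M.finsum_addf) (auto simp: f_eq[of _ ?A] subset_iff)
      finally show "f (x \<oplus>\<^bsub>?F\<^esub> y) = f x \<oplus>\<^bsub>M\<^esub> f y" .
    }
    {
      fix c assume c: "c \<in> carrier K"
      let ?A = "supp x"
      have A: "finite ?A" "?A \<subseteq> S" using x by (auto simp: F supp_def)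
      have sub: "supp (c \<odot>\<^bsub>?F\<^esub> x) \<subseteq> ?A"
        using c by (auto simp: supp_def free_module_def)
      have "f (c \<odot>\<^bsub>?F\<^esub> x) = (\<Oplus>\<^bsub>M\<^esub>s\<in>?A. (c \<odot>\<^bsub>?F\<^esub> x) s \<odot>\<^bsub>M\<^esub> u s)"
        using x c A sub by (intro f_eq) auto
      also have "\<dots> = (\<Oplus>\<^bsub>M\<^esub>s\<in>?A. c \<odot>\<^bsub>M\<^esub> (x s \<odot>\<^bsub>M\<^esub> u s))"
        using A(2) coeff[OF x] c u
        by (intro M.finsum_cong') (auto simp: free_module_def smult_assoc1 subset_iff)
      also have "\<dots> = c \<odot>\<^bsub>M\<^esub> f x"
        using A coeff[OF x] u c
        unfolding f_def by (subst finsum_smult_ldistr) (auto simp: subset_iff)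
      finally show "f (c \<odot>\<^bsub>?F\<^esub> x) = c \<odot>\<^bsub>M\<^esub> f x" .
    }
  qed
  moreover have "f (free_gen K S s) = u s" if s: "s \<in> S" for s
  proof -
    \<comment> \<open>\<open>K\<close> is only a commutative ring here: if one equals zero, the
      support of the generator is empty. The set \<open>{s}\<close> contains the support in either
      case.\<close>
    have "f (free_gen K S s) = (\<Oplus>\<^bsub>M\<^esub>t\<in>{s}. free_gen K S s t \<odot>\<^bsub>M\<^esub> u t)"
      using s by (intro f_eq free_gen_closed) 
        (auto simp: supp_def free_gen_def ext_direct_sum_inj_def R.is_cring split: if_splits)
    also have "\<dots> = u s"
      using s u by (simp add: free_gen_def ext_direct_sum_inj_def)
    finally show ?thesis .
  qed
  ultimately show thesis by (rule that)
qed

section \<open>Isomorphisms and transport of module structure\<close>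

lemma isomorphic_modulesI:
  assumes "f \<in> module_hom K M N"
    and "\<And>x. x \<in> carrier M \<Longrightarrow> g (f x) = x"
    and "\<And>y. y \<in> carrier N \<Longrightarrow> g y \<in> carrier M" "\<And>y. y \<in> carrier N \<Longrightarrow> f (g y) = y"
  shows "isomorphic_modules K M N"
  unfolding isomorphic_modules_def using assms
  by (intro bexI[of _ f] bij_betw_byWitness[where f' = g]) (auto simp: module_hom_def)

lemma isomorphic_modulesE:
  assumes "isomorphic_modules K M N" and M: "module K M"
  obtains f g where "f \<in> module_hom K M N" "g \<in> module_hom K N M"
    "\<And>x. x \<in> carrier M \<Longrightarrow> g (f x) = x" "\<And>y. y \<in> carrier N \<Longrightarrow> f (g y) = y"
proof -
  obtain f where f: "f \<in> module_hom K M N" and bij: "bij_betw f (carrier M) (carrier N)"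
    using assms by (auto simp: isomorphic_modules_def)
  define g where "g = inv_into (carrier M) f"
  have gf: "g (f x) = x" if "x \<in> carrier M" for x
    using bij that by (simp add: g_def bij_betw_inv_into_left)
  have fg: "f (g y) = y" and g: "g y \<in> carrier M" if "y \<in> carrier N" for y
    using bij that unfolding g_def by (auto simp: bij_betw_inv_into_right bij_betw_def inv_into_into)
  interpret module K M by fact
  have "g \<in> module_hom K N M"
  proof (rule module_homI)
    fix x assume x: "x \<in> carrier N"
    then show "g x \<in> carrier M" by (rule g)
    show "g (x \<oplus>\<^bsub>N\<^esub> y) = g x \<oplus>\<^bsub>M\<^esub> g y" if y: "y \<in> carrier N" for y
      using gf[of "g x \<oplus>\<^bsub>M\<^esub> g y"] x y g fg module_hom_add[OF f, of "g x" "g y"] by simp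
    show "g (c \<odot>\<^bsub>N\<^esub> x) = c \<odot>\<^bsub>M\<^esub> g x" if c: "c \<in> carrier K" for c
      using gf[of "c \<odot>\<^bsub>M\<^esub> g x"] x c g fg module_hom_smult[OF f, of c "g x"] by simp
  qed
  then show thesis using that f gf fg by blast
qed

lemma isomorphic_modules_sym:
  assumes "isomorphic_modules K M N" "module K M"
  shows "isomorphic_modules K N M"
proof -
  obtain f g where "f \<in> module_hom K M N" "g \<in> module_hom K N M"
    "\<And>x. x \<in> carrier M \<Longrightarrow> g (f x) = x" "\<And>y. y \<in> carrier N \<Longrightarrow> f (g y) = y"
    using isomorphic_modulesE[OF assms] by blast
  then show ?thesis
    by (intro isomorphic_modulesI[of g K N M f]) (auto dest: module_hom_in_carrier)
qed

lemma isomorphic_modules_trans: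
  assumes "isomorphic_modules K M N" "isomorphic_modules K N L"
  shows "isomorphic_modules K M L"
  using assms unfolding isomorphic_modules_def
  by (blast intro: module_hom_comp bij_betw_trans)

text \<open>Here \<open>N\<close> is a bare record of operations, and the axioms are carried over
  from \<open>M\<close>. Its \<open>zero\<close> field could a priori be any element, and
  \<open>module_hom\<close> says nothing about it, which is why the value of \<open>f\<close> at
  zero is a separate assumption.\<close>

lemma module_transfer:
  assumes M: "module K M" and f: "f \<in> module_hom K M N"
    and bij: "bij_betw f (carrier M) (carrier N)" and zero: "f \<zero>\<^bsub>M\<^esub> = \<zero>\<^bsub>N\<^esub>"
  shows "module K N"
proof -
  interpret module K M by fact
  have N: "carrier N = f ` carrier M" using bij by (simp add: bij_betw_def)
  \<comment> \<open>Used from right to left, these equations pull all operations on images inside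
    \<open>f\<close>, so that each axiom of \<open>N\<close> becomes \<open>f\<close> applied to the
    same axiom of \<open>M\<close>.\<close>
  note [simp] = module_hom_add[OF f, symmetric] module_hom_smult[OF f, symmetric]
    zero[symmetric]
  have neg: "\<exists>y\<in>carrier M. f (y \<oplus>\<^bsub>M\<^esub> x) = f \<zero>\<^bsub>M\<^esub>" if "x \<in> carrier M" for x
    using that by (intro bexI[of _ "\<ominus>\<^bsub>M\<^esub> x"]) (auto simp: M.l_neg simp del: zero)
  have comm: "f (x \<oplus>\<^bsub>M\<^esub> y) = f (y \<oplus>\<^bsub>M\<^esub> x)" if "x \<in> carrier M" "y \<in> carrier M" for x y
    using M.a_comm[OF that] by simp
  have "abelian_group N"
    by (rule abelian_groupI) (use neg in \<open>auto simp: N M.a_assoc intro: comm\<close>)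
  then show ?thesis
    by (rule moduleI[OF R.is_cring])
      (auto simp: N smult_l_distr smult_r_distr smult_assoc1)
qed

section \<open>Tensor products\<close>

text \<open>This says that \<open>M\<close> has a basis indexed by \<open>S\<close>. An external
  index set, in place of a subset of \<open>M\<close>, lets bases of modules over quite different
  element types be compared by bijections.\<close>

definition free_over ::
  "('k, 'r) ring_scheme \<Rightarrow> ('k, 'v, 'm) module_scheme \<Rightarrow> 's set \<Rightarrow> bool"
  where "free_over K M S \<longleftrightarrow> module K M \<and> isomorphic_modules K (free_module K S) M"

lemma free_overI:
  assumes "cring K" "f \<in> module_hom K (free_module K S) M"
    and "\<And>x. x \<in> carrier (free_module K S) \<Longrightarrow> g (f x) = x"
    and "\<And>y. y \<in> carrier M \<Longrightarrow> g y \<in> carrier (free_module K S)"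
    and "\<And>y. y \<in> carrier M \<Longrightarrow> f (g y) = y"
    and "f \<zero>\<^bsub>free_module K S\<^esub> = \<zero>\<^bsub>M\<^esub>"
  shows "free_over K M S"
proof -
  have "bij_betw f (carrier (free_module K S)) (carrier M)"
    using assms by (intro bij_betw_byWitness[where f' = g]) (auto simp: module_hom_def)
  moreover from this have "module K M"
    using module_transfer[of K "free_module K S" f M] module_free_module assms by metis
  ultimately show ?thesis
    using assms(2) by (auto simp: free_over_def isomorphic_modules_def)
qed

lemma free_overE:
  assumes "free_over K M S"
  obtains f g where "f \<in> module_hom K (free_module K S) M" "g \<in> module_hom K M (free_module K S)"
    "\<And>x. x \<in> carrier (free_module K S) \<Longrightarrow> g (f x) = x" "\<And>y. y \<in> carrier M \<Longrightarrow> f (g y) = y"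
proof -
  have "module K (free_module K S)"
    using assms module.axioms(1) by (auto simp: free_over_def intro: module_free_module)
  with assms show thesis
    by (auto simp: free_over_def elim!: isomorphic_modulesE intro: that)
qed

text \<open>The first isomorphism theorem, with the map going from \<open>L\<close> to the quotient:
  the cosets of the kernel are exactly the fibres of \<open>f\<close>, so sending a point of
  \<open>L\<close> to its fibre involves no choice of representatives. The quotient then inherits
  its module axioms from \<open>L\<close>.\<close>

lemma quotient_module_iso:
  assumes M: "module K M" and L: "module K L" and f: "f \<in> module_hom K M L"
    and surj: "f ` carrier M = carrier L"
  defines "N \<equiv> {x \<in> carrier M. f x = \<zero>\<^bsub>L\<^esub>}"
  shows "module K (quotient_module M N)" "isomorphic_modules K L (quotient_module M N)"
proof -
  interpret mod_hom K M L f
    using M L f by (simp add: mod_hom_def mod_hom_axioms_def)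
  let ?Q = "quotient_module M N"
  define P where "P a = {x \<in> carrier M. f x = a}" for a
  have coset: "N +>\<^bsub>M\<^esub> x = P (f x)" if x: "x \<in> carrier M" for x
  proof
    show "N +>\<^bsub>M\<^esub> x \<subseteq> P (f x)"
      using x by (auto simp: a_r_coset_def' N_def P_def)
    show "P (f x) \<subseteq> N +>\<^bsub>M\<^esub> x"
    proof
      fix y assume "y \<in> P (f x)"
      then have y: "y \<in> carrier M" "f y = f x" by (auto simp: P_def)
      then have "y \<ominus>\<^bsub>M\<^esub> x \<in> N" "y = (y \<ominus>\<^bsub>M\<^esub> x) \<oplus>\<^bsub>M\<^esub> x"
        using x by (auto simp: N_def a_minus_def M.M.a_assoc M.M.l_neg N.M.r_neg)
      then show "y \<in> N +>\<^bsub>M\<^esub> x" by (auto simp: a_r_coset_def')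
    qed
  qed
  have carrier: "carrier ?Q = P ` carrier L"
    using coset unfolding surj[symmetric] by (auto simp: quotient_module_def A_RCOSETS_def')
  have rep: "\<exists>x\<in>carrier M. f x = a" if "a \<in> carrier L" for a
    using that surj by (metis imageE)
  have image: "f ` P a = {a}" if "a \<in> carrier L" for a
    using rep[OF that] by (auto simp: P_def)
  have hom: "P \<in> module_hom K L ?Q"
  proof (rule module_homI)
    fix a assume a: "a \<in> carrier L"
    then show "P a \<in> carrier ?Q" by (simp add: carrier)
    obtain x where x: "x \<in> carrier M" "f x = a" using rep[OF a] by blast
    show "P (a \<oplus>\<^bsub>L\<^esub> b) = P a \<oplus>\<^bsub>?Q\<^esub> P b" if b: "b \<in> carrier L" for b
    proof
      show "P a \<oplus>\<^bsub>?Q\<^esub> P b \<subseteq> P (a \<oplus>\<^bsub>L\<^esub> b)"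
        by (auto simp: quotient_module_def set_add_def' P_def)
      show "P (a \<oplus>\<^bsub>L\<^esub> b) \<subseteq> P a \<oplus>\<^bsub>?Q\<^esub> P b"
      proof
        fix z assume "z \<in> P (a \<oplus>\<^bsub>L\<^esub> b)"
        then have z: "z \<in> carrier M" "f z = a \<oplus>\<^bsub>L\<^esub> b" by (auto simp: P_def)
        \<comment> \<open>With a point \<open>x\<close> over \<open>a\<close> fixed, any point
          \<open>z\<close> over the sum splits as \<open>x\<close> plus a remainder, and this
          remainder lies over \<open>b\<close>.\<close>
        have "f (\<ominus>\<^bsub>M\<^esub> x \<oplus>\<^bsub>M\<^esub> z) = b"
          using x z a b by (simp add: N.M.r_neg1)
        moreover have "z = x \<oplus>\<^bsub>M\<^esub> (\<ominus>\<^bsub>M\<^esub> x \<oplus>\<^bsub>M\<^esub> z)"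
          using x z by (simp add: M.M.r_neg2)
        ultimately have "\<exists>x\<in>P a. \<exists>y\<in>P b. z = x \<oplus>\<^bsub>M\<^esub> y"
          using x z by (intro bexI[of _ x] bexI[of _ "\<ominus>\<^bsub>M\<^esub> x \<oplus>\<^bsub>M\<^esub> z"]) (auto simp: P_def)
        then show "z \<in> P a \<oplus>\<^bsub>?Q\<^esub> P b"
          by (simp add: quotient_module_def set_add_def')
      qed
    qed
    show "P (c \<odot>\<^bsub>L\<^esub> a) = c \<odot>\<^bsub>?Q\<^esub> P a" if c: "c \<in> carrier K" for c
    proof -
      have "N +>\<^bsub>M\<^esub> (c \<odot>\<^bsub>M\<^esub> y) = P (c \<odot>\<^bsub>L\<^esub> a)" if "y \<in> P a" for y
        using that c coset[of "c \<odot>\<^bsub>M\<^esub> y"] by (auto simp: P_def)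
      \<comment> \<open>The scalar action on cosets is a union over the points of the fibre, all
        contributing the same coset; the union equals that coset because it is not an empty
        union.\<close>
      moreover have "P a \<noteq> {}" using x by (auto simp: P_def)
      ultimately show ?thesis by (auto simp: quotient_module_def)
    qed
  qed
  have bij: "bij_betw P (carrier L) (carrier ?Q)"
    using image by (auto simp: bij_betw_def carrier intro!: inj_onI) (metis singleton_inject)
  show "isomorphic_modules K L ?Q"
    using hom bij by (auto simp: isomorphic_modules_def)
  have "P \<zero>\<^bsub>L\<^esub> = \<zero>\<^bsub>?Q\<^esub>" by (auto simp: quotient_module_def P_def N_def)
  then show "module K ?Q" by (rule module_transfer[OF L hom bij])
qed

text \<open>If \<open>b\<close>, \<open>c\<close> are bases of \<open>V\<close>, \<open>W\<close> with coordinates \<open>v\<^sub>s\<close>, \<open>w\<^sub>t\<close>, then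
  \<open>(v, w) \<mapsto> (v\<^sub>s w\<^sub>t)\<close> extends to the free module on pairs of vectors as a map \<open>\<Phi>\<close> with section
  \<open>\<Psi>\<close> given by \<open>(s, t) \<mapsto> (b\<^sub>s, c\<^sub>t)\<close>. Modulo the bilinearity relations \<open>\<Psi> \<circ> \<Phi>\<close> is the
  identity, so they span the kernel of \<open>\<Phi>\<close>.\<close>

lemma free_over_tensor_product:
  assumes V: "free_over K V S" and W: "free_over K W T"
  shows "free_over K (tensor_product K V W) (S \<times> T)"
proof -
  let ?E = "free_module K (S \<times> T)" and ?F = "free_module K (carrier V \<times> carrier W)"
  define d where "d v w = free_gen K (carrier V \<times> carrier W) (v, w)" for v w
  define R where "R = bilinearity_relations K V W"
  obtain f f' where f: "f \<in> module_hom K (free_module K S) V"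
    and f': "f' \<in> module_hom K V (free_module K S)"
    and f'f: "\<And>x. x \<in> carrier (free_module K S) \<Longrightarrow> f' (f x) = x"
    and ff': "\<And>x. x \<in> carrier V \<Longrightarrow> f (f' x) = x"
    using free_overE[OF V] by blast
  obtain h h' where h: "h \<in> module_hom K (free_module K T) W"
    and h': "h' \<in> module_hom K W (free_module K T)"
    and h'h: "\<And>x. x \<in> carrier (free_module K T) \<Longrightarrow> h' (h x) = x"
    and hh': "\<And>x. x \<in> carrier W \<Longrightarrow> h (h' x) = x"
    using free_overE[OF W] by blast
  interpret V: module K V using V by (simp add: free_over_def)
  interpret W: module K W using W by (simp add: free_over_def)
  have K: "cring K" by (rule V.R.is_cring)
  interpret E: module K ?E by (rule module_free_module[OF K])
  interpret F: module K ?F by (rule module_free_module[OF K])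
  have d: "d v w \<in> carrier ?F" if "v \<in> carrier V" "w \<in> carrier W" for v w
    using that by (simp add: d_def free_gen_closed K)
  define u where "u v w = (\<lambda>(s, t)\<in>S \<times> T. f' v s \<otimes>\<^bsub>K\<^esub> h' w t)" for v w
  have f'_coeff: "f' v s \<in> carrier K" if "v \<in> carrier V" "s \<in> S" for v s
    using module_hom_in_carrier[OF f' that(1)] that(2) by (auto simp: free_module_def)
  have h'_coeff: "h' w t \<in> carrier K" if "w \<in> carrier W" "t \<in> T" for w t
    using module_hom_in_carrier[OF h' that(1)] that(2) by (auto simp: free_module_def)
  have u: "u v w \<in> carrier ?E" if v: "v \<in> carrier V" and w: "w \<in> carrier W" for v w
  proof -
    have "{i \<in> S \<times> T. u v w i \<noteq> \<zero>\<^bsub>K\<^esub>} \<subseteq> {s \<in> S. f' v s \<noteq> \<zero>\<^bsub>K\<^esub>} \<times> {t \<in> T. h' w t \<noteq> \<zero>\<^bsub>K\<^esub>}"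
      using f'_coeff[OF v] h'_coeff[OF w] by (auto simp: u_def)
    moreover have "finite ({s \<in> S. f' v s \<noteq> \<zero>\<^bsub>K\<^esub>} \<times> {t \<in> T. h' w t \<noteq> \<zero>\<^bsub>K\<^esub>})"
      using module_hom_in_carrier[OF f' v] module_hom_in_carrier[OF h' w]
      by (auto simp: free_module_def)
    ultimately have "finite {i \<in> S \<times> T. u v w i \<noteq> \<zero>\<^bsub>K\<^esub>}" by (rule finite_subset)
    then show ?thesis
      using f'_coeff[OF v] h'_coeff[OF w] by (auto simp: free_module_def u_def cong: conj_cong)
  qed
  obtain \<Phi> where \<Phi>: "\<Phi> \<in> module_hom K ?F ?E"
    and "\<And>p. p \<in> carrier V \<times> carrier W \<Longrightarrow>
      \<Phi> (free_gen K (carrier V \<times> carrier W) p) = (case p of (v, w) \<Rightarrow> u v w)"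
    by (rule free_module_lift[OF E.module_axioms, of "carrier V \<times> carrier W"
          "\<lambda>(v, w). u v w"]) (use u in auto)
  then have \<Phi>d: "\<Phi> (d v w) = u v w" if "v \<in> carrier V" "w \<in> carrier W" for v w
    using that by (simp add: d_def)
  define b where "b s = f (free_gen K S s)" for s
  define c where "c t = h (free_gen K T t)" for t
  have b: "b s \<in> carrier V" if "s \<in> S" for s
    using that by (simp add: b_def module_hom_in_carrier[OF f] free_gen_closed K)
  have c: "c t \<in> carrier W" if "t \<in> T" for t
    using that by (simp add: c_def module_hom_in_carrier[OF h] free_gen_closed K)
  obtain \<Psi> where \<Psi>: "\<Psi> \<in> module_hom K ?E ?F"
    and "\<And>p. p \<in> S \<times> T \<Longrightarrow> \<Psi> (free_gen K (S \<times> T) p) = (case p of (s, t) \<Rightarrow> d (b s) (c t))"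
    by (rule free_module_lift[OF F.module_axioms, of "S \<times> T"
          "\<lambda>(s, t). d (b s) (c t)"]) (use b c d in auto)
  then have \<Psi>e: "\<Psi> (free_gen K (S \<times> T) (s, t)) = d (b s) (c t)" if "s \<in> S" "t \<in> T" for s t
    using that by simp
  have ubc: "u (b s) (c t) = free_gen K (S \<times> T) (s, t)" if "s \<in> S" "t \<in> T" for s t
    using that
    by (auto simp: u_def b_def c_def f'f h'h free_gen_closed K fun_eq_iff)
      (auto simp: free_gen_def ext_direct_sum_inj_def)
  interpret \<Phi>: mod_hom K ?F ?E \<Phi>
    using \<Phi> by (simp add: mod_hom_def mod_hom_axioms_def E.module_axioms F.module_axioms)
  interpret \<Psi>: mod_hom K ?E ?F \<Psi>
    using \<Psi> by (simp add: mod_hom_def mod_hom_axioms_def E.module_axioms F.module_axioms)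
  have \<Phi>\<Psi>: "\<Phi> (\<Psi> a) = a" if a: "a \<in> carrier ?E" for a
  proof -
    have "(\<Phi> \<circ> \<Psi>) a = id a"
    proof (rule free_module_hom_eqI[OF K E.module_axioms _ _ _ a])
      show "\<Phi> \<circ> \<Psi> \<in> module_hom K ?E ?E" using \<Psi> \<Phi> by (rule module_hom_comp)
      show "id \<in> module_hom K ?E ?E" by (auto simp: module_hom_def)
    qed (use b c in \<open>auto simp: \<Psi>e \<Phi>d ubc\<close>)
    then show ?thesis by simp
  qed
  have u_bilinear:
    "\<lbrakk>v \<in> carrier V; v' \<in> carrier V; w \<in> carrier W\<rbrakk> \<Longrightarrow> u (v \<oplus>\<^bsub>V\<^esub> v') w = u v w \<oplus>\<^bsub>?E\<^esub> u v' w"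
    "\<lbrakk>v \<in> carrier V; w \<in> carrier W; w' \<in> carrier W\<rbrakk> \<Longrightarrow> u v (w \<oplus>\<^bsub>W\<^esub> w') = u v w \<oplus>\<^bsub>?E\<^esub> u v w'"
    "\<lbrakk>a \<in> carrier K; v \<in> carrier V; w \<in> carrier W\<rbrakk> \<Longrightarrow> u (a \<odot>\<^bsub>V\<^esub> v) w = a \<odot>\<^bsub>?E\<^esub> u v w"
    "\<lbrakk>a \<in> carrier K; v \<in> carrier V; w \<in> carrier W\<rbrakk> \<Longrightarrow> u v (a \<odot>\<^bsub>W\<^esub> w) = a \<odot>\<^bsub>?E\<^esub> u v w"
    for v v' w w' a
    by (auto simp: u_def fun_eq_iff free_module_def f'_coeff h'_coeff
        module_hom_add[OF f'] module_hom_smult[OF f'] module_hom_add[OF h'] module_hom_smult[OF h']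
        V.R.l_distr V.R.r_distr V.R.m_ac)
  have R_def': "R = {d (v \<oplus>\<^bsub>V\<^esub> v') w \<ominus>\<^bsub>?F\<^esub> (d v w \<oplus>\<^bsub>?F\<^esub> d v' w) | v v' w.
            v \<in> carrier V \<and> v' \<in> carrier V \<and> w \<in> carrier W}
      \<union> {d v (w \<oplus>\<^bsub>W\<^esub> w') \<ominus>\<^bsub>?F\<^esub> (d v w \<oplus>\<^bsub>?F\<^esub> d v w') | v w w'.
            v \<in> carrier V \<and> w \<in> carrier W \<and> w' \<in> carrier W}
      \<union> {d (a \<odot>\<^bsub>V\<^esub> v) w \<ominus>\<^bsub>?F\<^esub> a \<odot>\<^bsub>?F\<^esub> d v w | a v w.
            a \<in> carrier K \<and> v \<in> carrier V \<and> w \<in> carrier W}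
      \<union> {d v (a \<odot>\<^bsub>W\<^esub> w) \<ominus>\<^bsub>?F\<^esub> a \<odot>\<^bsub>?F\<^esub> d v w | a v w.
            a \<in> carrier K \<and> v \<in> carrier V \<and> w \<in> carrier W}"
    by (simp add: R_def bilinearity_relations_def d_def Let_def)
  \<comment> \<open>The easy inclusion: the coordinates \<open>u\<close> are bilinear, so
    \<open>\<Phi>\<close> kills every relation.\<close>
  have R_ker: "R \<subseteq> \<Phi>.ker"
    using d u by (auto simp: R_def' \<Phi>.ker_def \<Phi>d u_bilinear E.M.r_neg a_minus_def)
  have R_closed: "R \<subseteq> carrier ?F"
    using R_ker by (auto simp: \<Phi>.ker_def)
  define N where "N = F.span R"
  interpret N: LinearCombinations.submodule K N ?F
    unfolding N_def by (rule F.span_is_submodule[OF R_closed])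
  have RN: "r \<in> N" if "r \<in> R" for r
    using that F.in_own_span[OF R_closed] by (auto simp: N_def)
  \<comment> \<open>\<open>D\<close> is the projection onto the kernel of \<open>\<Phi>\<close>
    along the image of \<open>\<Psi>\<close>. It fixes the kernel pointwise, so the hard inclusion
    of the kernel in \<open>N\<close> follows once all values of \<open>D\<close> lie in
    \<open>N\<close>.\<close>
  define D where "D x = x \<ominus>\<^bsub>?F\<^esub> \<Psi> (\<Phi> x)" for x
  have D_add: "D (x \<oplus>\<^bsub>?F\<^esub> y) = D x \<oplus>\<^bsub>?F\<^esub> D y" if "x \<in> carrier ?F" "y \<in> carrier ?F" for x y
    using that by (simp add: D_def a_minus_def F.M.minus_add F.M.a_ac)
  have D_smult: "D (a \<odot>\<^bsub>?F\<^esub> x) = a \<odot>\<^bsub>?F\<^esub> D x" if "x \<in> carrier ?F" "a \<in> carrier K" for a x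
    using that by (simp add: D_def a_minus_def F.smult_r_distr F.smult_r_minus)
  have D_closed: "D x \<in> carrier ?F" if "x \<in> carrier ?F" for x
    using that by (simp add: D_def)
  have F_minus_zero [simp]: "\<ominus>\<^bsub>?F\<^esub> \<zero>\<^bsub>?F\<^esub> = \<zero>\<^bsub>?F\<^esub>"
    by (metis F.M.l_neg F.M.r_zero F.M.zero_closed F.M.a_inv_closed)
  have D_zero: "D \<zero>\<^bsub>?F\<^esub> = \<zero>\<^bsub>?F\<^esub>"
    by (simp add: D_def a_minus_def)
  have D_R: "D r \<in> N" if "r \<in> R" for r
  proof -
    have "\<Phi> r = \<zero>\<^bsub>?E\<^esub>" "r \<in> carrier ?F"
      using that R_ker by (auto simp: \<Phi>.ker_def)
    then show ?thesis using RN[OF that] by (simp add: D_def a_minus_def)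
  qed
  \<comment> \<open>Since \<open>D\<close> fixes each relation, a relation acts as a rewrite rule
    for the property of having \<open>D\<close>-value in \<open>N\<close>. The four closure facts
    below are this rule applied to the four kinds of relation.\<close>
  have D_cong: "D x \<in> N" if r: "x \<ominus>\<^bsub>?F\<^esub> y \<in> R" and y: "D y \<in> N" "y \<in> carrier ?F"
    and x: "x \<in> carrier ?F" for x y
  proof -
    have "x = (x \<ominus>\<^bsub>?F\<^esub> y) \<oplus>\<^bsub>?F\<^esub> y"
      using x y(2) by (simp add: a_minus_def F.M.a_assoc F.M.l_neg)
    then have "D x = D (x \<ominus>\<^bsub>?F\<^esub> y) \<oplus>\<^bsub>?F\<^esub> D y"
      using D_add[of "x \<ominus>\<^bsub>?F\<^esub> y" y] x y(2) by simp
    then show ?thesis using D_R[OF r] y(1) by simp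
  qed
  have relations:
    "\<lbrakk>v \<in> carrier V; v' \<in> carrier V; w \<in> carrier W\<rbrakk> \<Longrightarrow>
      d (v \<oplus>\<^bsub>V\<^esub> v') w \<ominus>\<^bsub>?F\<^esub> (d v w \<oplus>\<^bsub>?F\<^esub> d v' w) \<in> R"
    "\<lbrakk>v \<in> carrier V; w \<in> carrier W; w' \<in> carrier W\<rbrakk> \<Longrightarrow>
      d v (w \<oplus>\<^bsub>W\<^esub> w') \<ominus>\<^bsub>?F\<^esub> (d v w \<oplus>\<^bsub>?F\<^esub> d v w') \<in> R"
    "\<lbrakk>a \<in> carrier K; v \<in> carrier V; w \<in> carrier W\<rbrakk> \<Longrightarrow>
      d (a \<odot>\<^bsub>V\<^esub> v) w \<ominus>\<^bsub>?F\<^esub> a \<odot>\<^bsub>?F\<^esub> d v w \<in> R"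
    "\<lbrakk>a \<in> carrier K; v \<in> carrier V; w \<in> carrier W\<rbrakk> \<Longrightarrow>
      d v (a \<odot>\<^bsub>W\<^esub> w) \<ominus>\<^bsub>?F\<^esub> a \<odot>\<^bsub>?F\<^esub> d v w \<in> R"
    for v v' w w' a
    unfolding R_def' by blast+
  have D_v_add: "D (d (v \<oplus>\<^bsub>V\<^esub> v') w) \<in> N"
    if "D (d v w) \<in> N" "D (d v' w) \<in> N" "v \<in> carrier V" "v' \<in> carrier V" "w \<in> carrier W" for v v' w
    using that by (intro D_cong[OF relations(1)]) (simp_all add: d D_add)
  have D_v_smult: "D (d (a \<odot>\<^bsub>V\<^esub> v) w) \<in> N"
    if "D (d v w) \<in> N" "a \<in> carrier K" "v \<in> carrier V" "w \<in> carrier W" for a v w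
    using that by (intro D_cong[OF relations(3)]) (simp_all add: d D_smult)
  have D_w_add: "D (d v (w \<oplus>\<^bsub>W\<^esub> w')) \<in> N"
    if "D (d v w) \<in> N" "D (d v w') \<in> N" "v \<in> carrier V" "w' \<in> carrier W" "w \<in> carrier W" for v w' w
    using that by (intro D_cong[OF relations(2)]) (simp_all add: d D_add)
  have D_w_smult: "D (d v (a \<odot>\<^bsub>W\<^esub> w)) \<in> N"
    if "D (d v w) \<in> N" "a \<in> carrier K" "v \<in> carrier V" "w \<in> carrier W" for a v w
    using that by (intro D_cong[OF relations(4)]) (simp_all add: d D_smult)
  have D_v_zero: "D (d \<zero>\<^bsub>V\<^esub> w) \<in> N" if w: "w \<in> carrier W" for w
  proof -
    \<comment> \<open>Writing the zero vector as zero times itself makes the scalar relation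
      applicable; the other side of that relation is zero in the free module.\<close>
    have "D (d (\<zero>\<^bsub>K\<^esub> \<odot>\<^bsub>V\<^esub> \<zero>\<^bsub>V\<^esub>) w) \<in> N"
      using w D_closed[OF d] by (intro D_cong[OF relations(3)]) (simp_all add: d D_smult D_zero)
    then show ?thesis by simp
  qed
  have D_w_zero: "D (d v \<zero>\<^bsub>W\<^esub>) \<in> N" if v: "v \<in> carrier V" for v
  proof -
    have "D (d v (\<zero>\<^bsub>K\<^esub> \<odot>\<^bsub>W\<^esub> \<zero>\<^bsub>W\<^esub>)) \<in> N"
      using v D_closed[OF d] by (intro D_cong[OF relations(4)]) (simp_all add: d D_smult D_zero)
    then show ?thesis by simp
  qed
  have f0: "f \<zero>\<^bsub>free_module K S\<^esub> = \<zero>\<^bsub>V\<^esub>" and h0: "h \<zero>\<^bsub>free_module K T\<^esub> = \<zero>\<^bsub>W\<^esub>"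
    using module_hom_zero[OF module_free_module[OF K] _ f] module_hom_zero[OF module_free_module[OF K] _ h]
      V.module_axioms W.module_axioms by auto
  \<comment> \<open>On pairs of basis vectors \<open>\<Psi>\<close> undoes \<open>\<Phi>\<close>
    exactly, so \<open>D\<close> vanishes there.\<close>
  have D_bc: "D (d (b s) (c t)) \<in> N" if "s \<in> S" "t \<in> T" for s t
    using that b c d by (simp add: D_def \<Phi>d ubc \<Psi>e a_minus_def F.M.r_neg)
  \<comment> \<open>Bilinear extension from basis pairs, one argument at a time. Each vector is
    written as the image of its coordinates, so that induction over a free module applies.\<close>
  have D_b: "D (d (b s) (h y)) \<in> N" if s: "s \<in> S" and y: "y \<in> carrier (free_module K T)" for s y
    using K y
  proof (induction rule: free_module_induct)
    case zero
    then show ?case using D_w_zero b s h0 by simp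
  next
    case (gen t)
    then show ?case using D_bc[OF s gen] by (simp add: c_def)
  next
    case (add x y)
    then show ?case
      using D_w_add b s module_hom_add[OF h] module_hom_in_carrier[OF h] by simp
  next
    case (smult a x)
    then show ?case
      using D_w_smult b s module_hom_smult[OF h] module_hom_in_carrier[OF h] by simp
  qed
  have D_f: "D (d (f x) w) \<in> N" if w: "w \<in> carrier W" and x: "x \<in> carrier (free_module K S)" for x w
    using K x
  proof (induction rule: free_module_induct)
    case zero
    then show ?case using D_v_zero w f0 by simp
  next
    case (gen s)
    then show ?case using D_b[OF gen module_hom_in_carrier[OF h' w]] w by (simp add: hh' b_def)
  next
    case (add x y)
    then show ?case
      using D_v_add w module_hom_add[OF f] module_hom_in_carrier[OF f] by simp
  next
    case (smult a x)
    then show ?case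
      using D_v_smult w module_hom_smult[OF f] module_hom_in_carrier[OF f] by simp
  qed
  have D_d: "D (d v w) \<in> N" if "v \<in> carrier V" "w \<in> carrier W" for v w
    using D_f[of w "f' v"] that module_hom_in_carrier[OF f'] ff' by simp
  have D: "D x \<in> N" if x: "x \<in> carrier ?F" for x
    using K x
  proof (induction rule: free_module_induct)
    case zero
    then show ?case by (simp add: D_zero)
  next
    case (gen p)
    then show ?case using D_d by (auto simp: d_def)
  qed (use D_add D_smult in auto)
  have "N = {x \<in> carrier ?F. \<Phi> x = \<zero>\<^bsub>?E\<^esub>}"
  proof
    show "N \<subseteq> {x \<in> carrier ?F. \<Phi> x = \<zero>\<^bsub>?E\<^esub>}"
      using F.span_is_subset[OF R_ker \<Phi>.ker_is_submodule] by (simp add: N_def \<Phi>.ker_def)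
    show "{x \<in> carrier ?F. \<Phi> x = \<zero>\<^bsub>?E\<^esub>} \<subseteq> N"
      using D by (force simp: D_def a_minus_def)
  qed
  then have "tensor_product K V W = quotient_module ?F {x \<in> carrier ?F. \<Phi> x = \<zero>\<^bsub>?E\<^esub>}"
    by (simp add: tensor_product_def Let_def N_def R_def)
  moreover have "\<Phi> ` carrier ?F = carrier ?E"
    using \<Phi>\<Psi> by (force simp: image_iff)
  ultimately show ?thesis
    using quotient_module_iso[OF F.module_axioms E.module_axioms \<Phi>] by (simp add: free_over_def)
qed

section \<open>Bases\<close>

lemma free_module_simps:
  "x \<in> carrier (free_module K S) \<longleftrightarrow> x \<in> S \<rightarrow>\<^sub>E carrier K \<and> finite {s \<in> S. x s \<noteq> \<zero>\<^bsub>K\<^esub>}"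
  "\<zero>\<^bsub>free_module K S\<^esub> = (\<lambda>s\<in>S. \<zero>\<^bsub>K\<^esub>)"
  "x \<oplus>\<^bsub>free_module K S\<^esub> y = (\<lambda>s\<in>S. x s \<oplus>\<^bsub>K\<^esub> y s)"
  "c \<odot>\<^bsub>free_module K S\<^esub> x = (\<lambda>s\<in>S. c \<otimes>\<^bsub>K\<^esub> x s)"
  by (simp_all add: free_module_def)

lemma free_over_isomorphic_modules:
  assumes "free_over K M S" "free_over K N S"
  shows "isomorphic_modules K M N"
proof -
  have "module K (free_module K S)"
    using assms module.axioms(1) by (auto simp: free_over_def intro: module_free_module)
  then have "isomorphic_modules K M (free_module K S)"
    using assms(1) by (auto simp: free_over_def intro: isomorphic_modules_sym)
  then show ?thesis
    using assms(2) by (auto simp: free_over_def intro: isomorphic_modules_trans)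
qed

text \<open>Precomposition with \<open>p\<close> is contravariant, hence the reversed order of
  \<open>S\<close> and \<open>T\<close>. Preimages under a bijection keep supports finite.\<close>

lemma isomorphic_free_modules:
  assumes p: "bij_betw p S T"
  shows "isomorphic_modules K (free_module K T) (free_module K S)"
proof (rule isomorphic_modulesI)
  let ?f = "\<lambda>x. \<lambda>s\<in>S. x (p s)" and ?g = "\<lambda>y. \<lambda>t\<in>T. y (inv_into S p t)"
  have pS: "p s \<in> T" "inv_into S p (p s) = s" if "s \<in> S" for s
    using p that by (auto simp: bij_betw_def)
  have qT: "inv_into S p t \<in> S" "p (inv_into S p t) = t" if "t \<in> T" for t
    using p that by (auto simp: bij_betw_def inv_into_into f_inv_into_f)
  show "?f \<in> module_hom K (free_module K T) (free_module K S)"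
  proof (rule module_homI)
    fix x assume x: "x \<in> carrier (free_module K T)"
    have "{s \<in> S. x (p s) \<noteq> \<zero>\<^bsub>K\<^esub>} \<subseteq> inv_into S p ` {t \<in> T. x t \<noteq> \<zero>\<^bsub>K\<^esub>}"
      using pS by (force simp: image_iff)
    then have "finite {s \<in> S. x (p s) \<noteq> \<zero>\<^bsub>K\<^esub>}"
      by (rule finite_subset) (use x in \<open>simp add: free_module_simps\<close>)
    then show "?f x \<in> carrier (free_module K S)"
      using x pS by (auto simp: free_module_simps PiE_iff cong: conj_cong)
  qed (use pS in \<open>auto simp: free_module_simps fun_eq_iff\<close>)
  show "?g (?f x) = x" if "x \<in> carrier (free_module K T)" for x
    using that qT by (auto simp: free_module_simps fun_eq_iff PiE_iff extensional_def)
  show "?f (?g y) = y" if "y \<in> carrier (free_module K S)" for y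
    using that pS by (auto simp: free_module_simps fun_eq_iff PiE_iff extensional_def)
  show "?g y \<in> carrier (free_module K T)" if y: "y \<in> carrier (free_module K S)" for y
  proof -
    have "{t \<in> T. y (inv_into S p t) \<noteq> \<zero>\<^bsub>K\<^esub>} \<subseteq> p ` {s \<in> S. y s \<noteq> \<zero>\<^bsub>K\<^esub>}"
      using qT by (force simp: image_iff)
    then have "finite {t \<in> T. y (inv_into S p t) \<noteq> \<zero>\<^bsub>K\<^esub>}"
      by (rule finite_subset) (use y in \<open>simp add: free_module_simps\<close>)
    then show ?thesis
      using y qT by (auto simp: free_module_simps PiE_iff cong: conj_cong)
  qed
qed

lemma free_over_reindex:
  assumes "free_over K M T" "bij_betw p S T"
  shows "free_over K M S"
proof -
  have "module K (free_module K T)"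
    using assms module.axioms(1) by (auto simp: free_over_def intro: module_free_module)
  then have "isomorphic_modules K (free_module K S) (free_module K T)"
    using isomorphic_free_modules[OF assms(2)] isomorphic_modules_sym by blast
  then show ?thesis
    using assms(1) by (auto simp: free_over_def intro: isomorphic_modules_trans)
qed

text \<open>The basis serves as its own index set. \<open>basis_criterion\<close> yields unique
  coordinates among extensional functions, and the carrier of the free module is extensional too, so
  \<open>coords\<close> is an exact two-sided inverse of forming linear combinations.\<close>

lemma (in vectorspace) fin_dim_imp_free_over:
  assumes fin_dim
  shows "\<exists>B \<subseteq> carrier V. finite B \<and> free_over K V B"
proof -
  obtain B where B: "finite B" "basis B"
    using finite_basis_exists[OF assms] by blast
  then have BV: "B \<subseteq> carrier V" by (simp add: basis_def)
  then have ex1: "\<exists>!a. a \<in> B \<rightarrow>\<^sub>E carrier K \<and> lincomb a B = v" if "v \<in> carrier V" for v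
    using basis_criterion[OF B(1) BV] B(2) that by blast
  define coords where "coords v = (THE a. a \<in> B \<rightarrow>\<^sub>E carrier K \<and> lincomb a B = v)" for v
  have coords: "coords v \<in> B \<rightarrow>\<^sub>E carrier K" "lincomb (coords v) B = v" if "v \<in> carrier V" for v
    using theI'[OF ex1[OF that]] by (auto simp: coords_def)
  have closed: "lincomb a B \<in> carrier V" if "a \<in> B \<rightarrow>\<^sub>E carrier K" for a
    using that BV by (intro lincomb_closed) auto
  have "free_over K V B"
  proof (rule free_overI)
    show "cring K" by (rule R.is_cring)
    show "(\<lambda>a. lincomb a B) \<in> module_hom K (free_module K B) V"
    proof (rule module_homI)
      fix a assume a: "a \<in> carrier (free_module K B)"
      then have a': "\<And>b. b \<in> B \<Longrightarrow> a b \<in> carrier K" by (auto simp: free_module_simps)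
      show "lincomb a B \<in> carrier V" using a closed by (simp add: free_module_simps)
      show "lincomb (a \<oplus>\<^bsub>free_module K B\<^esub> a') B = lincomb a B \<oplus>\<^bsub>V\<^esub> lincomb a' B"
        if "a' \<in> carrier (free_module K B)" for a'
      proof -
        have "\<And>b. b \<in> B \<Longrightarrow> a' b \<in> carrier K" using that by (auto simp: free_module_simps)
        then have "lincomb (a \<oplus>\<^bsub>free_module K B\<^esub> a') B =
            (\<Oplus>\<^bsub>V\<^esub>v\<in>B. a v \<odot>\<^bsub>V\<^esub> v \<oplus>\<^bsub>V\<^esub> a' v \<odot>\<^bsub>V\<^esub> v)"
          unfolding lincomb_def using a' BV
          by (intro M.finsum_cong') (auto simp: free_module_simps smult_l_distr subset_iff)
        also have "\<dots> = lincomb a B \<oplus>\<^bsub>V\<^esub> lincomb a' B"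
          unfolding lincomb_def using a' BV \<open>\<And>b. b \<in> B \<Longrightarrow> a' b \<in> carrier K\<close>
          by (intro M.finsum_addf) auto
        finally show ?thesis .
      qed
      show "lincomb (c \<odot>\<^bsub>free_module K B\<^esub> a) B = c \<odot>\<^bsub>V\<^esub> lincomb a B" if "c \<in> carrier K" for c
      proof -
        have "lincomb (c \<odot>\<^bsub>free_module K B\<^esub> a) B = (\<Oplus>\<^bsub>V\<^esub>v\<in>B. c \<odot>\<^bsub>V\<^esub> (a v \<odot>\<^bsub>V\<^esub> v))"
          unfolding lincomb_def using a' BV that
          by (intro M.finsum_cong') (auto simp: free_module_simps smult_assoc1 subset_iff)
        also have "\<dots> = c \<odot>\<^bsub>V\<^esub> lincomb a B"
          unfolding lincomb_def using a' BV that B(1)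
          by (intro finsum_smult_ldistr[symmetric]) auto
        finally show ?thesis .
      qed
    qed
    show "coords (lincomb a B) = a" if "a \<in> carrier (free_module K B)" for a
      unfolding coords_def
      by (rule the1_equality[OF ex1[OF closed]]) (use that in \<open>auto simp: free_module_simps\<close>)
    show "coords v \<in> carrier (free_module K B)" if "v \<in> carrier V" for v
      using coords[OF that] B(1) by (simp add: free_module_simps)
    show "lincomb \<zero>\<^bsub>free_module K B\<^esub> B = \<zero>\<^bsub>V\<^esub>"
      unfolding lincomb_def using BV
      by (intro M.add.finprod_one_eqI) (auto simp: free_module_simps)
  qed (use coords in auto)
  with B(1) BV show ?thesis by blast
qed

text \<open>A family over the disjoint union is the same as a family of slices, to which the
  isomorphisms \<open>f i\<close> apply one by one. Finiteness of \<open>I\<close> settles both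
  support conditions: any family over \<open>I\<close> has finite support, and finitely many finite
  supports glue to a finite one.\<close>

lemma free_over_ext_direct_sum:
  assumes K: "cring K" and I: "finite I" and M: "\<And>i. i \<in> I \<Longrightarrow> free_over K (M i) (S i)"
  shows "free_over K (ext_direct_sum I M) (Sigma I S)"
proof -
  have "\<exists>f g. f \<in> module_hom K (free_module K (S i)) (M i) \<and>
      g \<in> module_hom K (M i) (free_module K (S i)) \<and>
      (\<forall>x\<in>carrier (free_module K (S i)). g (f x) = x) \<and> (\<forall>y\<in>carrier (M i). f (g y) = y)"
    if "i \<in> I" for i
    using free_overE[OF M[OF that]] by metis
  then obtain f g where f: "\<And>i. i \<in> I \<Longrightarrow> f i \<in> module_hom K (free_module K (S i)) (M i)"
    and g: "\<And>i. i \<in> I \<Longrightarrow> g i \<in> module_hom K (M i) (free_module K (S i))"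
    and gf: "\<And>i x. i \<in> I \<Longrightarrow> x \<in> carrier (free_module K (S i)) \<Longrightarrow> g i (f i x) = x"
    and fg: "\<And>i y. i \<in> I \<Longrightarrow> y \<in> carrier (M i) \<Longrightarrow> f i (g i y) = y"
    by metis
  define slice where "slice i a = (\<lambda>s\<in>S i. a (i, s))" for i and a :: "_ \<Rightarrow> 'a"
  have slice: "slice i a \<in> carrier (free_module K (S i))"
    if "a \<in> carrier (free_module K (Sigma I S))" "i \<in> I" for i a
  proof -
    have "Pair i ` {s \<in> S i. a (i, s) \<noteq> \<zero>\<^bsub>K\<^esub>} \<subseteq> {p \<in> Sigma I S. a p \<noteq> \<zero>\<^bsub>K\<^esub>}"
      using that(2) by auto
    then have "finite (Pair i ` {s \<in> S i. a (i, s) \<noteq> \<zero>\<^bsub>K\<^esub>})"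
      by (rule finite_subset) (use that(1) in \<open>simp add: free_module_simps\<close>)
    then have "finite {s \<in> S i. a (i, s) \<noteq> \<zero>\<^bsub>K\<^esub>}"
      by (rule finite_imageD) (simp add: inj_on_def)
    then show ?thesis
      using that by (auto simp: free_module_simps slice_def PiE_iff cong: conj_cong)
  qed
  have slice_add: "slice i (a \<oplus>\<^bsub>free_module K (Sigma I S)\<^esub> b) =
      slice i a \<oplus>\<^bsub>free_module K (S i)\<^esub> slice i b" if "i \<in> I" for i a b
    using that by (auto simp: slice_def free_module_simps fun_eq_iff)
  have slice_smult: "slice i (c \<odot>\<^bsub>free_module K (Sigma I S)\<^esub> a) =
      c \<odot>\<^bsub>free_module K (S i)\<^esub> slice i a" if "i \<in> I" for i a c
    using that by (auto simp: slice_def free_module_simps fun_eq_iff)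
  have slice_zero: "slice i \<zero>\<^bsub>free_module K (Sigma I S)\<^esub> = \<zero>\<^bsub>free_module K (S i)\<^esub>" if "i \<in> I" for i
    using that by (auto simp: slice_def free_module_simps fun_eq_iff)
  define G where "G x = (\<lambda>(i, s)\<in>Sigma I S. g i (x i) s)" for x
  have slice_G: "slice i (G x) = g i (x i)" if "i \<in> I" "x \<in> carrier (ext_direct_sum I M)" for i x
    using that module_hom_in_carrier[OF g, of i "x i"]
    by (auto simp: slice_def G_def free_module_simps fun_eq_iff PiE_iff extensional_def)
  show ?thesis
  proof (rule free_overI[OF K, where g = G])
    show "(\<lambda>a. \<lambda>i\<in>I. f i (slice i a)) \<in> module_hom K (free_module K (Sigma I S)) (ext_direct_sum I M)"
      by (rule module_homI)
        (use module_hom_in_carrier[OF f] module_hom_add[OF f] module_hom_smult[OF f] slice I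
          in \<open>auto simp: slice_add slice_smult fun_eq_iff\<close>)
    show "(\<lambda>i\<in>I. f i (slice i \<zero>\<^bsub>free_module K (Sigma I S)\<^esub>)) = \<zero>\<^bsub>ext_direct_sum I M\<^esub>"
      using module_hom_zero[OF module_free_module[OF K] _ f] M
      by (auto simp: slice_zero fun_eq_iff free_over_def)
    show "G (\<lambda>i\<in>I. f i (slice i a)) = a" if a: "a \<in> carrier (free_module K (Sigma I S))" for a
      using a gf[OF _ slice[OF a]]
      by (auto simp: G_def fun_eq_iff free_module_simps PiE_iff extensional_def)
        (auto simp: slice_def)
    fix x assume x: "x \<in> carrier (ext_direct_sum I M)"
    show "(\<lambda>i\<in>I. f i (slice i (G x))) = x"
    proof
      fix i show "(\<lambda>i\<in>I. f i (slice i (G x))) i = x i"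
        using x slice_G[OF _ x] by (cases "i \<in> I") (auto simp: fg PiE_iff extensional_def)
    qed
    have gx: "g i (x i) \<in> carrier (free_module K (S i))" if "i \<in> I" for i
      using that x module_hom_in_carrier[OF g] by auto
    have "{p \<in> Sigma I S. G x p \<noteq> \<zero>\<^bsub>K\<^esub>} \<subseteq> Sigma I (\<lambda>i. {s \<in> S i. g i (x i) s \<noteq> \<zero>\<^bsub>K\<^esub>})"
      by (auto simp: G_def)
    then have "finite {p \<in> Sigma I S. G x p \<noteq> \<zero>\<^bsub>K\<^esub>}"
      by (rule finite_subset) (use I gx in \<open>auto simp: free_module_simps\<close>)
    then show "G x \<in> carrier (free_module K (Sigma I S))"
      using gx by (auto simp: G_def free_module_simps PiE_iff cong: conj_cong)
  qed
qed

lemma free_over_graded_tensor: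
  assumes K: "cring K" and G: "finite (carrier G)"
    and V: "\<And>h. h \<in> carrier G \<Longrightarrow> free_over K (V h) (S h)"
    and W: "\<And>h. h \<in> carrier G \<Longrightarrow> free_over K (W h) (T h)"
  shows "free_over K (graded_tensor G K V W g)
    (SIGMA (h, k):{(h, k). h \<in> carrier G \<and> k \<in> carrier G \<and> h \<otimes>\<^bsub>G\<^esub> k = g}. S h \<times> T k)"
  unfolding graded_tensor_def
proof (rule free_over_ext_direct_sum[OF K])
  show "finite {(h, k). h \<in> carrier G \<and> k \<in> carrier G \<and> h \<otimes>\<^bsub>G\<^esub> k = g}"
    by (rule finite_subset[of _ "carrier G \<times> carrier G"]) (use G in auto)
qed (auto intro: free_over_tensor_product V W)

section \<open>Graded duals\<close>

lemma ext_direct_sum_inj_hom: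
  assumes M: "\<And>i. i \<in> I \<Longrightarrow> module K (M i)" and i: "i \<in> I"
  shows "ext_direct_sum_inj I M i \<in> module_hom K (M i) (ext_direct_sum I M)"
proof (rule module_homI)
  fix x assume "x \<in> carrier (M i)"
  with i show "ext_direct_sum_inj I M i x \<in> carrier (ext_direct_sum I M)"
    by (intro ext_direct_sum_inj_closed[of I K M] M)
next
  have "\<zero>\<^bsub>M j\<^esub> \<oplus>\<^bsub>M j\<^esub> \<zero>\<^bsub>M j\<^esub> = \<zero>\<^bsub>M j\<^esub>" if "j \<in> I" for j
    using M[OF that] by (simp add: module_def abelian_group_def abelian_monoid.l_zero
        abelian_monoid.zero_closed)
  then show "ext_direct_sum_inj I M i (x \<oplus>\<^bsub>M i\<^esub> y) =
      ext_direct_sum_inj I M i x \<oplus>\<^bsub>ext_direct_sum I M\<^esub> ext_direct_sum_inj I M i y" for x y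
    by (auto simp: ext_direct_sum_inj_def fun_eq_iff)
next
  fix c x assume "c \<in> carrier K"
  then show "ext_direct_sum_inj I M i (c \<odot>\<^bsub>M i\<^esub> x) = c \<odot>\<^bsub>ext_direct_sum I M\<^esub> ext_direct_sum_inj I M i x"
    using module.smult_r_null[OF M] by (auto simp: ext_direct_sum_inj_def fun_eq_iff)
qed

lemma ext_direct_sum_proj_hom:
  "i \<in> I \<Longrightarrow> (\<lambda>x. x i) \<in> module_hom K (ext_direct_sum I M) (M i)"
  by (auto intro!: module_homI)

lemma ext_direct_sum_inj_zero:
  "ext_direct_sum_inj I M i \<zero>\<^bsub>M i\<^esub> = \<zero>\<^bsub>ext_direct_sum I M\<^esub>"
  by (auto simp: ext_direct_sum_inj_def fun_eq_iff)

lemma module_graded_line: "cring K \<Longrightarrow> module K (graded_line K g\<^sub>0 h)"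
proof -
  assume "cring K"
  then interpret cring K .
  have "module K (self_module K\<lparr>carrier := {\<zero>\<^bsub>K\<^esub>}\<rparr>)"
    by (rule moduleI, rule is_cring, rule abelian_groupI) (auto simp: self_module_def)
  then show ?thesis by (simp add: graded_line_def module_self_module)
qed

text \<open>This is the dual basis in coordinates. \<open>E\<close> turns a family of scalars into
  the functional with these values on the basis of the component of degree \<open>h\<^sub>0\<close>,
  and \<open>C\<close> reads the values back. With \<open>S\<close> finite the pairing is a finite
  sum and every family of values is finitely supported.\<close>

lemma free_over_graded_dual:
  fixes G :: "('g, 'a) monoid_scheme" and K :: "('k, 'r) ring_scheme"
    and V :: "('g, 'k, 'v) graded"
  assumes G: "group G" and K: "cring K" and g: "g \<in> carrier G" and g\<^sub>0: "g\<^sub>0 \<in> carrier G"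
    and V: "\<And>h. h \<in> carrier G \<Longrightarrow> module K (V h)"
    and S: "finite S" "free_over K (V (inv\<^bsub>G\<^esub> g \<otimes>\<^bsub>G\<^esub> g\<^sub>0)) S"
  shows "free_over K (graded_dual G K g\<^sub>0 V g) S"
proof -
  interpret G: group G by fact
  interpret K: cring K by fact
  define h\<^sub>0 where "h\<^sub>0 = inv\<^bsub>G\<^esub> g \<otimes>\<^bsub>G\<^esub> g\<^sub>0"
  have h\<^sub>0: "h\<^sub>0 \<in> carrier G" and gh\<^sub>0: "g \<otimes>\<^bsub>G\<^esub> h\<^sub>0 = g\<^sub>0"
    using g g\<^sub>0 by (simp_all add: h\<^sub>0_def G.m_assoc[symmetric])
  have gh: "g \<otimes>\<^bsub>G\<^esub> h \<noteq> g\<^sub>0" if "h \<in> carrier G" "h \<noteq> h\<^sub>0" for h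
    using that g h\<^sub>0 gh\<^sub>0 by (metis G.inv_solve_left h\<^sub>0_def g\<^sub>0)
  let ?T = "ext_direct_sum (carrier G) V" and ?P = "graded_line K g\<^sub>0"
  let ?L = "ext_direct_sum (carrier G) ?P" and ?F = "free_module K S"
  let ?H = "graded_dual G K g\<^sub>0 V g"
  let ?inj = "ext_direct_sum_inj (carrier G) V"
  define \<iota> where "\<iota> = ext_direct_sum_inj (carrier G) ?P g\<^sub>0"
  have Pg\<^sub>0: "?P g\<^sub>0 = self_module K"
    by (simp add: graded_line_def)
  have P: "carrier (?P h) = {\<zero>\<^bsub>K\<^esub>}" if "h \<noteq> g\<^sub>0" for h
    using that by (simp add: graded_line_def)
  have P_zero: "\<zero>\<^bsub>?P h\<^esub> = \<zero>\<^bsub>K\<^esub>" for h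
    by (simp add: graded_line_def self_module_def)
  have T: "module K ?T" using K V by (rule module_ext_direct_sum)
  have L: "module K ?L" using K module_graded_line[OF K] by (rule module_ext_direct_sum)
  have \<iota>: "\<iota> \<in> module_hom K (self_module K) ?L"
    using ext_direct_sum_inj_hom[of "carrier G" K ?P g\<^sub>0, OF module_graded_line[OF K] g\<^sub>0]
    by (simp add: \<iota>_def Pg\<^sub>0)
  have \<iota>_g\<^sub>0: "\<iota> c g\<^sub>0 = c" for c
    using g\<^sub>0 by (simp add: \<iota>_def ext_direct_sum_inj_def)
  have \<iota>_zero: "\<iota> \<zero>\<^bsub>K\<^esub> = \<zero>\<^bsub>?L\<^esub>"
    unfolding \<iota>_def using ext_direct_sum_inj_zero[of _ ?P g\<^sub>0] unfolding P_zero .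
  obtain f f' where f: "f \<in> module_hom K ?F (V h\<^sub>0)" and f': "f' \<in> module_hom K (V h\<^sub>0) ?F"
    and f'f: "\<And>x. x \<in> carrier ?F \<Longrightarrow> f' (f x) = x"
    and ff': "\<And>x. x \<in> carrier (V h\<^sub>0) \<Longrightarrow> f (f' x) = x"
    using free_overE[OF S(2)] unfolding h\<^sub>0_def by blast
  \<comment> \<open>The dot product of coordinate vectors. Only linearity in the second argument is
    proved from sums; its symmetry transfers this to the first, which gives the linearity of
    \<open>E\<close>.\<close>
  define pair where "pair a b = (\<Oplus>\<^bsub>K\<^esub>s\<in>S. a s \<otimes>\<^bsub>K\<^esub> b s)" for a b
  have coeff: "a s \<in> carrier K" if "a \<in> carrier ?F" "s \<in> S" for a s
    using that by (auto simp: free_module_simps)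
  have pair_closed: "pair a b \<in> carrier K" if "a \<in> carrier ?F" "b \<in> carrier ?F" for a b
    unfolding pair_def using that by (intro K.finsum_closed) (auto simp: coeff)
  have pair_comm: "pair a b = pair b a" if "a \<in> carrier ?F" "b \<in> carrier ?F" for a b
    unfolding pair_def using that by (intro K.finsum_cong') (auto simp: coeff K.m_comm)
  have pair_add: "pair a (b \<oplus>\<^bsub>?F\<^esub> b') = pair a b \<oplus>\<^bsub>K\<^esub> pair a b'"
    if "a \<in> carrier ?F" "b \<in> carrier ?F" "b' \<in> carrier ?F" for a b b'
  proof -
    have "pair a (b \<oplus>\<^bsub>?F\<^esub> b') = (\<Oplus>\<^bsub>K\<^esub>s\<in>S. a s \<otimes>\<^bsub>K\<^esub> b s \<oplus>\<^bsub>K\<^esub> a s \<otimes>\<^bsub>K\<^esub> b' s)"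
      unfolding pair_def using that
      by (intro K.finsum_cong') (auto simp: coeff free_module_simps(3) K.r_distr)
    also have "\<dots> = pair a b \<oplus>\<^bsub>K\<^esub> pair a b'"
      unfolding pair_def using that by (intro K.finsum_addf) (auto simp: coeff)
    finally show ?thesis .
  qed
  have pair_smult: "pair a (c \<odot>\<^bsub>?F\<^esub> b) = c \<otimes>\<^bsub>K\<^esub> pair a b"
    if "a \<in> carrier ?F" "b \<in> carrier ?F" "c \<in> carrier K" for a b c
  proof -
    have "pair a (c \<odot>\<^bsub>?F\<^esub> b) = (\<Oplus>\<^bsub>K\<^esub>s\<in>S. c \<otimes>\<^bsub>K\<^esub> (a s \<otimes>\<^bsub>K\<^esub> b s))"
      unfolding pair_def using that
      by (intro K.finsum_cong') (auto simp: coeff free_module_simps(4) K.m_lcomm)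
    also have "\<dots> = c \<otimes>\<^bsub>K\<^esub> pair a b"
      unfolding pair_def using that S(1)
      by (intro K.finsum_rdistr[symmetric]) (auto simp: coeff)
    finally show ?thesis .
  qed
  have pair_hom: "pair a \<in> module_hom K ?F (self_module K)" if "a \<in> carrier ?F" for a
    using that by (intro module_homI) (auto simp: pair_closed pair_add pair_smult)
  have gen: "free_gen K S s \<in> carrier ?F" if "s \<in> S" for s
    using free_gen_closed[OF K that] .
  have F: "module K ?F" by (rule module_free_module[OF K])
  interpret F: module K ?F by (rule F)
  have pair_gen: "pair a (free_gen K S s) = a s" if "a \<in> carrier ?F" "s \<in> S" for a s
  proof -
    have "pair a (free_gen K S s) = (\<Oplus>\<^bsub>K\<^esub>t\<in>S. if s = t then a t else \<zero>\<^bsub>K\<^esub>)"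
      unfolding pair_def using that
      by (intro K.finsum_cong') (auto simp: coeff free_gen_def ext_direct_sum_inj_def)
    also have "\<dots> = a s"
      using that S(1) by (intro K.finsum_singleton) (auto simp: coeff)
    finally show ?thesis .
  qed
  \<comment> \<open>Project to degree \<open>h\<^sub>0\<close>, take coordinates, pair with
    \<open>a\<close>, and place the scalar in degree \<open>g\<^sub>0\<close> of the line. As a
    composite of homomorphisms it is linear; the restriction in \<open>E\<close> only makes it
    extensional, as the Hom space demands.\<close>
  define E\<^sub>0 where "E\<^sub>0 a = \<iota> \<circ> (pair a \<circ> (f' \<circ> (\<lambda>x. x h\<^sub>0)))" for a
  have E\<^sub>0: "E\<^sub>0 a \<in> module_hom K ?T ?L" if "a \<in> carrier ?F" for a
    unfolding E\<^sub>0_def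
    by (intro module_hom_comp[OF _ \<iota>] module_hom_comp[OF _ pair_hom[OF that]]
        module_hom_comp[OF _ f'] ext_direct_sum_proj_hom h\<^sub>0)
  have f'_proj: "f' (x h\<^sub>0) \<in> carrier ?F" if "x \<in> carrier ?T" for x
    using that h\<^sub>0 by (auto intro: module_hom_in_carrier[OF f'])
  have f'_zero: "f' \<zero>\<^bsub>V h\<^sub>0\<^esub> = \<zero>\<^bsub>?F\<^esub>" by (rule module_hom_zero[OF V[OF h\<^sub>0] F f'])
  have pair_zero: "pair a \<zero>\<^bsub>?F\<^esub> = \<zero>\<^bsub>K\<^esub>" if "a \<in> carrier ?F" for a
    using module_hom_zero[OF F K.module_self_module pair_hom[OF that]] by simp
  have E\<^sub>0_other: "E\<^sub>0 a (?inj h v) = \<zero>\<^bsub>?L\<^esub>" if "a \<in> carrier ?F" "h \<noteq> h\<^sub>0" for a h v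
    using that h\<^sub>0 by (simp add: E\<^sub>0_def ext_direct_sum_inj_def f'_zero pair_zero \<iota>_zero)
  have E\<^sub>0_h\<^sub>0: "E\<^sub>0 a (?inj h\<^sub>0 v) = \<iota> (pair a (f' v))" for a v
    using h\<^sub>0 by (simp add: E\<^sub>0_def ext_direct_sum_inj_def)
  define E where "E a = restrict (E\<^sub>0 a) (carrier ?T)" for a
  have inj_closed: "?inj h v \<in> carrier ?T" if "h \<in> carrier G" "v \<in> carrier (V h)" for h v
    using ext_direct_sum_inj_closed[of "carrier G" K V, OF V that] .
  have H_carrier: "\<phi> \<in> carrier ?H \<longleftrightarrow> \<phi> \<in> module_hom K ?T ?L \<and> \<phi> \<in> extensional (carrier ?T) \<and>
      (\<forall>h\<in>carrier G. \<forall>v\<in>carrier (V h).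
        \<phi> (?inj h v) \<in> ext_direct_sum_inj (carrier G) ?P (g \<otimes>\<^bsub>G\<^esub> h) ` carrier (?P (g \<otimes>\<^bsub>G\<^esub> h)))" for \<phi>
    by (simp only: graded_dual_def graded_Hom_def total_space_def homogeneous_part_def
        module.simps partial_object.simps) (simp del: ext_direct_sum_simps add: image_subset_iff)
  have H_other: "\<phi> (?inj h v) = \<zero>\<^bsub>?L\<^esub>"
    if "\<phi> \<in> carrier ?H" "h \<in> carrier G" "h \<noteq> h\<^sub>0" "v \<in> carrier (V h)" for \<phi> h v
  proof -
    have "\<phi> (?inj h v) \<in> ext_direct_sum_inj (carrier G) ?P (g \<otimes>\<^bsub>G\<^esub> h) ` carrier (?P (g \<otimes>\<^bsub>G\<^esub> h))"
      using that unfolding H_carrier by blast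
    then show ?thesis
      unfolding P[OF gh[OF that(2,3)]]
      using ext_direct_sum_inj_zero[of "carrier G" ?P "g \<otimes>\<^bsub>G\<^esub> h"] unfolding P_zero by simp
  qed
  \<comment> \<open>The degree condition puts these values into the single nonzero component of the
    line, so the coordinate at \<open>g\<^sub>0\<close> retains all information and \<open>C\<close>
    loses nothing.\<close>
  have H_h\<^sub>0: "\<phi> (?inj h\<^sub>0 v) = \<iota> (\<phi> (?inj h\<^sub>0 v) g\<^sub>0)" "\<phi> (?inj h\<^sub>0 v) g\<^sub>0 \<in> carrier K"
    if "\<phi> \<in> carrier ?H" "v \<in> carrier (V h\<^sub>0)" for \<phi> v
  proof -
    have "\<phi> (?inj h\<^sub>0 v) \<in> \<iota> ` carrier K"
      using that h\<^sub>0 gh\<^sub>0 unfolding H_carrier \<iota>_def by (auto simp: graded_line_def)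
    then show "\<phi> (?inj h\<^sub>0 v) = \<iota> (\<phi> (?inj h\<^sub>0 v) g\<^sub>0)" "\<phi> (?inj h\<^sub>0 v) g\<^sub>0 \<in> carrier K"
      by (auto simp: \<iota>_g\<^sub>0)
  qed
  have f_gen: "f (free_gen K S s) \<in> carrier (V h\<^sub>0)" if "s \<in> S" for s
    using that module_hom_in_carrier[OF f] gen by blast
  define C where "C \<phi> = (\<lambda>s\<in>S. \<phi> (?inj h\<^sub>0 (f (free_gen K S s))) g\<^sub>0)" for \<phi> :: "('g \<Rightarrow> 'v) \<Rightarrow> 'g \<Rightarrow> 'k"
  have E_hom: "E a \<in> module_hom K ?T ?L" if "a \<in> carrier ?F" for a
  proof -
    interpret T: module K ?T by (rule T)
    show ?thesis
      using E\<^sub>0[OF that] by (simp add: E_def module_hom_def Pi_iff del: ext_direct_sum_simps)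
  qed
  have C_closed: "C \<phi> \<in> carrier ?F" if "\<phi> \<in> carrier ?H" for \<phi>
    using H_h\<^sub>0(2)[OF that f_gen] S(1) by (auto simp: C_def free_module_simps)
  show ?thesis
  proof (rule free_overI[OF K, where g = C])
    show "E \<in> module_hom K ?F ?H"
    proof (rule module_homI)
      fix a assume a: "a \<in> carrier ?F"
      have "E a (?inj h v) \<in> ext_direct_sum_inj (carrier G) ?P (g \<otimes>\<^bsub>G\<^esub> h) ` carrier (?P (g \<otimes>\<^bsub>G\<^esub> h))"
        if h: "h \<in> carrier G" and v: "v \<in> carrier (V h)" for h v
      proof (cases "h = h\<^sub>0")
        case True
        have "\<iota> (pair a (f' v)) \<in> \<iota> ` carrier K"
          using v a True by (auto intro!: pair_closed module_hom_in_carrier[OF f'])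
        then show ?thesis
          using inj_closed[OF h v] E\<^sub>0_h\<^sub>0[of a v] True
          by (simp add: E_def gh\<^sub>0 \<iota>_def graded_line_def del: ext_direct_sum_simps)
      next
        case False
        have "ext_direct_sum_inj (carrier G) ?P (g \<otimes>\<^bsub>G\<^esub> h) \<zero>\<^bsub>?P (g \<otimes>\<^bsub>G\<^esub> h)\<^esub> = E a (?inj h v)"
          using inj_closed[OF h v] E\<^sub>0_other[OF a False]
          by (simp add: E_def ext_direct_sum_inj_zero del: ext_direct_sum_simps)
        then show ?thesis
          using gh[OF h False] by (auto simp: P P_zero)
      qed
      then show "E a \<in> carrier ?H"
        unfolding H_carrier using E_hom[OF a] by (simp add: E_def del: ext_direct_sum_simps)
      have add: "E\<^sub>0 (a \<oplus>\<^bsub>?F\<^esub> b) x = E\<^sub>0 a x \<oplus>\<^bsub>?L\<^esub> E\<^sub>0 b x"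
        if b: "b \<in> carrier ?F" and x: "x \<in> carrier ?T" for b x
        using a b f'_proj[OF x] module_hom_add[OF \<iota>, of "pair a (f' (x h\<^sub>0))" "pair b (f' (x h\<^sub>0))"]
        by (simp add: E\<^sub>0_def pair_comm[of _ "f' (x h\<^sub>0)"] pair_add pair_closed del: ext_direct_sum_simps)
      show "E (a \<oplus>\<^bsub>?F\<^esub> b) = E a \<oplus>\<^bsub>?H\<^esub> E b" if b: "b \<in> carrier ?F" for b
        using add[OF b] by (simp add: E_def graded_dual_def graded_Hom_def total_space_def fun_eq_iff
            del: ext_direct_sum_simps)
      have smult: "E\<^sub>0 (c \<odot>\<^bsub>?F\<^esub> a) x = c \<odot>\<^bsub>?L\<^esub> E\<^sub>0 a x"
        if c: "c \<in> carrier K" and x: "x \<in> carrier ?T" for c x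
        using a c f'_proj[OF x] module_hom_smult[OF \<iota>, of c "pair a (f' (x h\<^sub>0))"]
        by (simp add: E\<^sub>0_def pair_comm[of _ "f' (x h\<^sub>0)"] pair_smult pair_closed del: ext_direct_sum_simps)
      show "E (c \<odot>\<^bsub>?F\<^esub> a) = c \<odot>\<^bsub>?H\<^esub> E a" if c: "c \<in> carrier K" for c
        using smult[OF c] by (simp add: E_def graded_dual_def graded_Hom_def total_space_def fun_eq_iff
            del: ext_direct_sum_simps)
    qed
    show "C (E a) = a" if a: "a \<in> carrier ?F" for a
    proof -
      have "E a (?inj h\<^sub>0 (f (free_gen K S s))) g\<^sub>0 = a s" if s: "s \<in> S" for s
        using inj_closed[OF h\<^sub>0 f_gen[OF s]] f'f[OF gen[OF s]] pair_gen[OF a s]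
        by (simp add: E_def E\<^sub>0_h\<^sub>0 \<iota>_g\<^sub>0 del: ext_direct_sum_simps)
      then show ?thesis
        using a by (auto simp: C_def free_module_simps fun_eq_iff PiE_iff extensional_def)
    qed
    show "C \<phi> \<in> carrier ?F" if "\<phi> \<in> carrier ?H" for \<phi> using that by (rule C_closed)
    show "E (C \<phi>) = \<phi>" if \<phi>: "\<phi> \<in> carrier ?H" for \<phi>
    proof -
      have \<phi>_hom: "\<phi> \<in> module_hom K ?T ?L" using \<phi> by (simp only: H_carrier)
      note C = C_closed[OF \<phi>]
      note inj_hom = ext_direct_sum_inj_hom[of "carrier G" K V, OF V h\<^sub>0]
      \<comment> \<open>Both maps are pulled back to the free module, where agreement on generators
        suffices and holds by the choice of \<open>C\<close>. In all other degrees both maps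
        vanish.\<close>
      have eq_h\<^sub>0: "(E\<^sub>0 (C \<phi>) \<circ> (?inj h\<^sub>0 \<circ> f)) b = (\<phi> \<circ> (?inj h\<^sub>0 \<circ> f)) b" if b: "b \<in> carrier ?F" for b
      proof (rule free_module_hom_eqI[OF K L _ _ _ b])
        show "E\<^sub>0 (C \<phi>) \<circ> (?inj h\<^sub>0 \<circ> f) \<in> module_hom K ?F ?L"
          by (rule module_hom_comp[OF module_hom_comp[OF f inj_hom] E\<^sub>0[OF C]])
        show "\<phi> \<circ> (?inj h\<^sub>0 \<circ> f) \<in> module_hom K ?F ?L"
          by (rule module_hom_comp[OF module_hom_comp[OF f inj_hom] \<phi>_hom])
        fix s assume s: "s \<in> S"
        then show "(E\<^sub>0 (C \<phi>) \<circ> (?inj h\<^sub>0 \<circ> f)) (free_gen K S s) = (\<phi> \<circ> (?inj h\<^sub>0 \<circ> f)) (free_gen K S s)"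
          using H_h\<^sub>0(1)[OF \<phi> f_gen[OF s]] pair_gen[OF C s]
          by (simp add: E\<^sub>0_h\<^sub>0 f'f gen) (simp add: C_def)
      qed
      have "E\<^sub>0 (C \<phi>) x = \<phi> x" if x: "x \<in> carrier ?T" for x
      proof (rule ext_direct_sum_hom_eqI[OF V K L E\<^sub>0[OF C] \<phi>_hom _ x])
        fix h v assume h: "h \<in> carrier G" and v: "v \<in> carrier (V h)"
        show "E\<^sub>0 (C \<phi>) (?inj h v) = \<phi> (?inj h v)"
        proof (cases "h = h\<^sub>0")
          case True
          then show ?thesis
            using eq_h\<^sub>0[of "f' v"] v ff' module_hom_in_carrier[OF f'] by simp
        next
          case False
          then show ?thesis using E\<^sub>0_other[OF C] H_other[OF \<phi> h _ v] by simp
        qed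
      qed
      moreover have "\<phi> \<in> extensional (carrier ?T)" using \<phi> by (simp only: H_carrier)
      ultimately show ?thesis
        by (auto simp: E_def fun_eq_iff extensional_def simp del: ext_direct_sum_simps)
    qed
    have "E\<^sub>0 \<zero>\<^bsub>?F\<^esub> x = \<zero>\<^bsub>?L\<^esub>" if x: "x \<in> carrier ?T" for x
      using f'_proj[OF x] by (simp add: E\<^sub>0_def pair_comm[of _ "f' (x h\<^sub>0)"] pair_zero \<iota>_zero
          del: ext_direct_sum_simps)
    then show "E \<zero>\<^bsub>?F\<^esub> = \<zero>\<^bsub>?H\<^esub>"
      by (simp add: E_def graded_dual_def graded_Hom_def total_space_def fun_eq_iff
          del: ext_direct_sum_simps)
  qed
qed

section \<open>Comparing the index sets of the two sides\<close>

theorem lemma4p2p5: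
  fixes G :: "('g, 'a) monoid_scheme" and K :: "('k, 'r) ring_scheme"
    and V :: "('g, 'k, 'v) graded" and W :: "('g, 'k, 'w) graded"
  assumes "comm_group G" and "finite (carrier G)"
    and "field K"
    and "g \<in> carrier G" and "g\<^sub>0 \<in> carrier G"
    and "graded_vectorspace G K V" and "graded_fin_dim G K V"
    and "graded_vectorspace G K W" and "graded_fin_dim G K W"
  shows "isomorphic_modules K
    (dual_graded_tensor G K g\<^sub>0 V W g)
    (graded_tensor G K V W (g \<otimes>\<^bsub>G\<^esub> g\<^sub>0))"
proof -
  interpret G: comm_group G by fact
  interpret K: field K by fact
  have K: "cring K" by (rule K.is_cring)
  have group: "group G" by (rule G.is_group)
  note g = assms(4) and g\<^sub>0 = assms(5)
  have "\<exists>B :: 'v set. finite B \<and> free_over K (V h) B" if h: "h \<in> carrier G" for h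
  proof -
    interpret vectorspace K "V h"
      using assms(6) h by (simp add: graded_vectorspace_def)
    show ?thesis
      using fin_dim_imp_free_over assms(7) h by (auto simp: graded_fin_dim_def)
  qed
  then obtain B :: "'g \<Rightarrow> 'v set"
    where basis_V: "\<forall>h\<in>carrier G. finite (B h) \<and> free_over K (V h) (B h)"
    using bchoice[of "carrier G" "\<lambda>h B. finite B \<and> free_over K (V h) B"] by meson
  then have B: "finite (B h)" and V: "free_over K (V h) (B h)" if "h \<in> carrier G" for h
    using that by simp_all
  have "\<exists>B :: 'w set. finite B \<and> free_over K (W h) B" if h: "h \<in> carrier G" for h
  proof -
    interpret vectorspace K "W h"
      using assms(8) h by (simp add: graded_vectorspace_def)
    show ?thesis
      using fin_dim_imp_free_over assms(9) h by (auto simp: graded_fin_dim_def)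
  qed
  then obtain C :: "'g \<Rightarrow> 'w set"
    where basis_W: "\<forall>h\<in>carrier G. finite (C h) \<and> free_over K (W h) (C h)"
    using bchoice[of "carrier G" "\<lambda>h B. finite B \<and> free_over K (W h) B"] by meson
  then have C: "finite (C h)" and W: "free_over K (W h) (C h)" if "h \<in> carrier G" for h
    using that by simp_all
  \<comment> \<open>Several orders of the factors are covered, because the order produced by
    \<open>m_ac\<close> depends on the term ordering.\<close>
  have cancel: "x \<otimes>\<^bsub>G\<^esub> (y \<otimes>\<^bsub>G\<^esub> inv\<^bsub>G\<^esub> x) = y" "x \<otimes>\<^bsub>G\<^esub> (inv\<^bsub>G\<^esub> x \<otimes>\<^bsub>G\<^esub> y) = y"
    "inv\<^bsub>G\<^esub> x \<otimes>\<^bsub>G\<^esub> (y \<otimes>\<^bsub>G\<^esub> x) = y" "inv\<^bsub>G\<^esub> x \<otimes>\<^bsub>G\<^esub> (x \<otimes>\<^bsub>G\<^esub> y) = y"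
    if "x \<in> carrier G" "y \<in> carrier G" for x y
    using that G.m_comm[of x y] G.m_comm[of "inv\<^bsub>G\<^esub> x" y]
    by (simp_all add: G.m_assoc[symmetric]) (simp_all add: G.m_assoc)
  define t where "t h = inv\<^bsub>G\<^esub> h \<otimes>\<^bsub>G\<^esub> g\<^sub>0" for h
  have t: "t h \<in> carrier G" if "h \<in> carrier G" for h
    using that g\<^sub>0 by (simp add: t_def)
  have tt: "t (t h) = h" if "h \<in> carrier G" for h
    using that g\<^sub>0 by (simp add: t_def G.inv_mult G.m_ac cancel)
  \<comment> \<open>The left side contains \<open>g\<^sub>0\<close> twice, while \<open>t\<close>
    supplies it once; the inverse of \<open>g\<^sub>0\<close> under the inverting \<open>t\<close>
    provides the second copy.\<close>
  have t_mult: "t h \<otimes>\<^bsub>G\<^esub> t k = t (inv\<^bsub>G\<^esub> g\<^sub>0 \<otimes>\<^bsub>G\<^esub> (h \<otimes>\<^bsub>G\<^esub> k))" if "h \<in> carrier G" "k \<in> carrier G" for h k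
    using that g\<^sub>0 by (simp add: t_def G.inv_mult G.m_ac cancel)
  define J where "J x = {(h, k). h \<in> carrier G \<and> k \<in> carrier G \<and> h \<otimes>\<^bsub>G\<^esub> k = x}" for x
  have finite_J: "finite (J x)" for x
    by (rule finite_subset[of _ "carrier G \<times> carrier G"]) (use assms(2) in \<open>auto simp: J_def\<close>)
  have dual_V: "free_over K (graded_dual G K g\<^sub>0 V h) (B (t h))" if "h \<in> carrier G" for h
    using free_over_graded_dual[OF group K that g\<^sub>0, of V "B (t h)"] V B t[OF that]
    by (auto simp: t_def free_over_def)
  have dual_W: "free_over K (graded_dual G K g\<^sub>0 W h) (C (t h))" if "h \<in> carrier G" for h
    using free_over_graded_dual[OF group K that g\<^sub>0, of W "C (t h)"] W C t[OF that]
    by (auto simp: t_def free_over_def)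
  define D where "D = graded_tensor G K (graded_dual G K g\<^sub>0 V) (graded_dual G K g\<^sub>0 W)"
  have D: "free_over K (D x) (SIGMA (h, k):J x. B (t h) \<times> C (t k))" for x
    unfolding D_def J_def by (rule free_over_graded_tensor[OF K assms(2) dual_V dual_W])
  have finite: "finite (SIGMA (h, k):J (t g). B (t h) \<times> C (t k))"
    using finite_J by (auto intro!: finite_SigmaI B C t simp: J_def)
  have dual: "free_over K (graded_dual G K g\<^sub>0 D g) (SIGMA (h, k):J (t g). B (t h) \<times> C (t k))"
  \<comment> \<open>The outer dual in degree \<open>g\<close> only sees the component of
    \<open>D\<close> in degree \<open>t g\<close>, and its basis carries the same index set as that
    component.\<close>
  proof (rule free_over_graded_dual[OF group K g g\<^sub>0 _ finite])
    show "module K (D x)" for x using D[of x] by (simp add: free_over_def)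
    show "free_over K (D (inv\<^bsub>G\<^esub> g \<otimes>\<^bsub>G\<^esub> g\<^sub>0)) (SIGMA (h, k):J (t g). B (t h) \<times> C (t k))"
      using D[of "t g"] unfolding t_def[of g] .
  qed
  have tensor: "free_over K (graded_tensor G K V W (g \<otimes>\<^bsub>G\<^esub> g\<^sub>0))
      (SIGMA (h, k):J (g \<otimes>\<^bsub>G\<^esub> g\<^sub>0). B h \<times> C k)"
    unfolding J_def by (rule free_over_graded_tensor[OF K assms(2) V W])
  have J_t: "(t h, t k) \<in> J (g \<otimes>\<^bsub>G\<^esub> g\<^sub>0)" if "(h, k) \<in> J (t g)" for h k
  proof -
    have "t (inv\<^bsub>G\<^esub> g\<^sub>0 \<otimes>\<^bsub>G\<^esub> t g) = g \<otimes>\<^bsub>G\<^esub> g\<^sub>0"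
      using g g\<^sub>0 by (simp add: t_def G.inv_mult G.m_ac cancel)
    then show ?thesis using that t t_mult by (auto simp: J_def)
  qed
  have t_J: "(t h, t k) \<in> J (t g)" if "(h, k) \<in> J (g \<otimes>\<^bsub>G\<^esub> g\<^sub>0)" for h k
  proof -
    have "t (inv\<^bsub>G\<^esub> g\<^sub>0 \<otimes>\<^bsub>G\<^esub> (g \<otimes>\<^bsub>G\<^esub> g\<^sub>0)) = t g"
      using g g\<^sub>0 by (simp add: t_def G.inv_mult G.m_ac cancel)
    then show ?thesis using that t t_mult by (auto simp: J_def)
  qed
  \<comment> \<open>Only degrees move; the pair of basis vectors stays put. Because \<open>t\<close>
    is an involution, the same formula is also the inverse map.\<close>
  let ?p = "\<lambda>((h, k), b). ((t h, t k), b)"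
  have "bij_betw ?p (SIGMA (h, k):J (g \<otimes>\<^bsub>G\<^esub> g\<^sub>0). B h \<times> C k) (SIGMA (h, k):J (t g). B (t h) \<times> C (t k))"
    by (rule bij_betw_byWitness[where f' = ?p])
      (use J_t t_J in \<open>auto simp: tt J_def\<close>)
  then have "free_over K (graded_dual G K g\<^sub>0 D g) (SIGMA (h, k):J (g \<otimes>\<^bsub>G\<^esub> g\<^sub>0). B h \<times> C k)"
    by (rule free_over_reindex[OF dual])
  then show ?thesis
    unfolding dual_graded_tensor_def D_def[symmetric] using tensor by (rule free_over_isomorphic_modules)
qed

end
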